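(* Let $V$ be a (potentially unbounded) self-adjoint operator on a Hilbert space $H$, and let $\{U^t\}_{t\in\mathbb{R}}$, $U^t=e^{itV}$, be the strongly continuous one-parameter unitary group on $H$ generated by $V$. Then $\mathcal{M}_V$, the von Neumann algebra generated by the spectral projections of $V$, coincides with $\{U^t\}_{t\in\mathbb{R}}''\subseteq\mathcal{B}(H)$.
   Context: For $S\subseteq\mathcal{B}(H)$, $S''$ denotes the double commutant. *)

theory Defs
  imports "HOL-Analysis.Analysis"
begin

section \<open>Complex Hilbert spaces\<close>

text \<open>The inner product is conjugate-linear in the first and linear in the second argument.
  Positive definiteness is contained in \<open>cinner_norm\<close>; completeness comes from \<^class>\<open>banach\<close>.\<close>

class complex_hilbert_space = banach +
  fixes scaleC :: "complex \<Rightarrow> 'a \<Rightarrow> 'a" (infixr "*\<^sub>C" 75)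
    and cinner :: "'a \<Rightarrow> 'a \<Rightarrow> complex"
  assumes scaleC_add_right: "c *\<^sub>C (x + y) = c *\<^sub>C x + c *\<^sub>C y"
    and scaleC_add_left: "(c + d) *\<^sub>C x = c *\<^sub>C x + d *\<^sub>C x"
    and scaleC_scaleC: "c *\<^sub>C d *\<^sub>C x = (c * d) *\<^sub>C x"
    and scaleC_of_real: "complex_of_real r *\<^sub>C x = r *\<^sub>R x"
    and cinner_commute: "cinner x y = cnj (cinner y x)"
    and cinner_add_right: "cinner x (y + z) = cinner x y + cinner x z"
    and cinner_scaleC_right: "cinner x (c *\<^sub>C y) = c * cinner x y"
    and cinner_norm: "cinner x x = complex_of_real ((norm x)\<^sup>2)"

section \<open>Bounded operators and von Neumann algebras\<close>

definition bounded_ops :: "('a::complex_hilbert_space \<Rightarrow> 'a) set" where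
  "bounded_ops = {T. (\<forall>x y. T (x + y) = T x + T y) \<and> (\<forall>c x. T (c *\<^sub>C x) = c *\<^sub>C T x) \<and>
     (\<exists>K. \<forall>x. norm (T x) \<le> K * norm x)}"

definition bounded_adjoint :: "('a::complex_hilbert_space \<Rightarrow> 'a) \<Rightarrow> 'a \<Rightarrow> 'a" where
  "bounded_adjoint T y = (THE z. \<forall>x. cinner (T x) y = cinner x z)"

definition commutant :: "('a::complex_hilbert_space \<Rightarrow> 'a) set \<Rightarrow> ('a \<Rightarrow> 'a) set" where
  "commutant S = {T \<in> bounded_ops. \<forall>A\<in>S. T \<circ> A = A \<circ> T}"

definition von_neumann_algebra :: "('a::complex_hilbert_space \<Rightarrow> 'a) set \<Rightarrow> bool" where
  "von_neumann_algebra M \<longleftrightarrow>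
     M \<subseteq> bounded_ops \<and> id \<in> M \<and>
     (\<forall>S\<in>M. \<forall>T\<in>M. (\<lambda>x. S x + T x) \<in> M) \<and>
     (\<forall>c. \<forall>T\<in>M. (\<lambda>x. c *\<^sub>C T x) \<in> M) \<and>
     (\<forall>S\<in>M. \<forall>T\<in>M. S \<circ> T \<in> M) \<and>
     (\<forall>T\<in>M. bounded_adjoint T \<in> M) \<and>
     commutant (commutant M) = M"

definition von_neumann_generated ::
    "('a::complex_hilbert_space \<Rightarrow> 'a) set \<Rightarrow> ('a \<Rightarrow> 'a) set" where
  "von_neumann_generated S = \<Inter> {M. von_neumann_algebra M \<and> S \<subseteq> M}"

section \<open>Unbounded operators\<close>

text \<open>A possibly unbounded operator is a partial function \<open>V\<close> with domain \<open>dom V\<close>;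
  equality of operators, including equality of domains, is equality of partial functions.\<close>

definition linear_operator :: "('a::complex_hilbert_space \<rightharpoonup> 'a) \<Rightarrow> bool" where
  "linear_operator V \<longleftrightarrow> 0 \<in> dom V \<and>
     (\<forall>x\<in>dom V. \<forall>y\<in>dom V. V (x + y) = Some (the (V x) + the (V y))) \<and>
     (\<forall>c. \<forall>x\<in>dom V. V (c *\<^sub>C x) = Some (c *\<^sub>C the (V x)))"

text \<open>The vector \<open>z\<close> below is unique when \<open>dom V\<close> is dense, the only case in which
  the adjoint is used.\<close>

definition unbounded_adjoint :: "('a::complex_hilbert_space \<rightharpoonup> 'a) \<Rightarrow> ('a \<rightharpoonup> 'a)" where
  "unbounded_adjoint V y =
     (if \<exists>z. \<forall>x\<in>dom V. cinner (the (V x)) y = cinner x z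
      then Some (THE z. \<forall>x\<in>dom V. cinner (the (V x)) y = cinner x z)
      else None)"

definition self_adjoint :: "('a::complex_hilbert_space \<rightharpoonup> 'a) \<Rightarrow> bool" where
  "self_adjoint V \<longleftrightarrow> linear_operator V \<and> closure (dom V) = UNIV \<and> unbounded_adjoint V = V"

section \<open>Spectral measures and functional calculus\<close>

definition orthogonal_projection :: "('a::complex_hilbert_space \<Rightarrow> 'a) \<Rightarrow> bool" where
  "orthogonal_projection P \<longleftrightarrow>
     P \<in> bounded_ops \<and> P \<circ> P = P \<and> (\<forall>x y. cinner (P x) y = cinner x (P y))"

text \<open>Only the values of \<open>E\<close> on Borel sets are meaningful.\<close>

definition projection_valued_measure ::
    "(real set \<Rightarrow> 'a::complex_hilbert_space \<Rightarrow> 'a) \<Rightarrow> bool" where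
  "projection_valued_measure E \<longleftrightarrow>
     (\<forall>B\<in>sets borel. orthogonal_projection (E B)) \<and>
     E {} = (\<lambda>x. 0) \<and> E UNIV = id \<and>
     (\<forall>A\<in>sets borel. \<forall>B\<in>sets borel. E (A \<inter> B) = E A \<circ> E B) \<and>
     (\<forall>B. range B \<subseteq> sets borel \<longrightarrow> disjoint_family B \<longrightarrow>
        (\<forall>x. (\<lambda>n::nat. E (B n) x) sums E (\<Union>n. B n) x))"

text \<open>The scalar measure \<open>B \<mapsto> \<langle>x, E(B) x\<rangle> = \<parallel>E(B) x\<parallel>\<^sup>2\<close>.\<close>

definition scalar_measure ::
    "(real set \<Rightarrow> 'a::complex_hilbert_space \<Rightarrow> 'a) \<Rightarrow> 'a \<Rightarrow> real measure" where
  "scalar_measure E x = measure_of UNIV (sets borel) (\<lambda>B. ennreal (Re (cinner x (E B x))))"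

text \<open>\<open>T\<close> is the operator \<open>\<integral> f dE\<close>: its domain consists of all \<open>x\<close> for which
  \<open>f\<close> is square integrable with respect to \<open>\<langle>x, E(\<cdot>) x\<rangle>\<close>, and
  \<open>\<langle>x, T x\<rangle> = \<integral> f(l) d\<langle>x, E(l) x\<rangle>\<close> there. By polarization and density of this domain,
  at most one linear operator has these properties.\<close>

definition is_spectral_integral ::
    "(real set \<Rightarrow> 'a::complex_hilbert_space \<Rightarrow> 'a) \<Rightarrow> (real \<Rightarrow> complex) \<Rightarrow> ('a \<rightharpoonup> 'a) \<Rightarrow> bool" where
  "is_spectral_integral E f T \<longleftrightarrow> linear_operator T \<and>
     dom T = {x. integrable (scalar_measure E x) (\<lambda>l. (cmod (f l))\<^sup>2)} \<and>
     (\<forall>x\<in>dom T. cinner x (the (T x)) = (LINT l|scalar_measure E x. f l))"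

definition is_spectral_measure ::
    "('a::complex_hilbert_space \<rightharpoonup> 'a) \<Rightarrow> (real set \<Rightarrow> 'a \<Rightarrow> 'a) \<Rightarrow> bool" where
  "is_spectral_measure V E \<longleftrightarrow>
     projection_valued_measure E \<and> is_spectral_integral E complex_of_real V"

text \<open>For self-adjoint \<open>V\<close> the spectral theorem gives existence, and uniqueness on Borel sets,
  so the choice below affects only the irrelevant values on non-Borel sets.\<close>

definition spectral_measure ::
    "('a::complex_hilbert_space \<rightharpoonup> 'a) \<Rightarrow> real set \<Rightarrow> 'a \<Rightarrow> 'a" where
  "spectral_measure V = (SOME E. is_spectral_measure V E)"

definition spectral_projections ::
    "('a::complex_hilbert_space \<rightharpoonup> 'a) \<Rightarrow> ('a \<Rightarrow> 'a) set" where
  "spectral_projections V = spectral_measure V ` sets borel"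

definition functional_calculus ::
    "('a::complex_hilbert_space \<rightharpoonup> 'a) \<Rightarrow> (real \<Rightarrow> complex) \<Rightarrow> ('a \<rightharpoonup> 'a)" where
  "functional_calculus V f = (THE T. is_spectral_integral (spectral_measure V) f T)"

text \<open>The operator \<open>e\<^bsup>itV\<^esup>\<close>; it is everywhere defined because the integrand is bounded.\<close>

definition exp_itV :: "('a::complex_hilbert_space \<rightharpoonup> 'a) \<Rightarrow> real \<Rightarrow> 'a \<Rightarrow> 'a" where
  "exp_itV V t x =
     the (functional_calculus V (\<lambda>l. exp (\<i> * complex_of_real t * complex_of_real l)) x)"

end

theory Submission
  imports Defs "HOL-Probability.Probability"
begin

text \<open>The commutant of the spectral projections equals the commutant of the group: the functions
  whose operators commute with a fixed bounded operator form an algebra closed under bounded pointwise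
  limits, and such an algebra contains all indicators of Borel sets as soon as it contains the
  exponentials, and vice versa. As the spectral projections are self-adjoint, the algebra
  they generate is their double commutant.

  This presupposes that a spectral measure exists. The Cayley transform of \<open>V\<close> is unitary; its
  orbit of a unit vector has trigonometric moments that are approximated by Fejer measures, and Helly
  selection yields a measure with exactly these moments. By the mean ergodic theorem
  it has no mass at \<open>1\<close>, so it can be transported to the real line, and the calculus of
  polynomials in the Cayley transform extends to bounded Borel functions through bounded
  pointwise limits.\<close>

section \<open>Complex inner product spaces\<close>

text \<open>One abstract calculus serves twice. With indicators and the projections of a given
  measure as basic triples it compares the two commutants; with monomials in the Cayley transform
  and its conjugate it produces the measure. In both cases only the quadratic form
  \<open>cinner x (T x)\<close> is tied to a measure. Over the complex numbers this form determines
  \<open>T\<close>, so the operator attached to a function is unique although the moment measures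
  are only known to exist. They are chosen for each vector separately, and their dependence on the
  vector is recovered afterwards from the calculus. The Cayley transform replaces \<open>V\<close>
  by an everywhere defined operator; the delicate point is the way back, since the domain of
  \<open>V\<close> has to be exactly the set of square integrable vectors. The link is the resolvent
  \<open>R\<close>, the inverse of V + \<i>. It represents the function 1 / (l + \<i>), its range is
  \<open>dom V\<close>, and the measure of \<open>R y\<close> has density 1 / (1 + l^2) with respect
  to that of \<open>y\<close>. Both inclusions between the domains and the formula for the form of
  \<open>V\<close> are read off from these facts.\<close>

lemma cinner_add_left: "cinner (x + y) z = cinner x z + cinner y (z::'a::complex_hilbert_space)"
  by (metis cinner_commute cinner_add_right complex_cnj_add)

lemma cinner_scaleC_left: "cinner (c *\<^sub>C x) y = cnj c * cinner x (y::'a::complex_hilbert_space)"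
  by (metis cinner_commute cinner_scaleC_right complex_cnj_mult)

lemma cinner_scaleR_right: "cinner x (r *\<^sub>R y) = r *\<^sub>R cinner x (y::'a::complex_hilbert_space)"
  by (metis cinner_scaleC_right scaleC_of_real scaleR_conv_of_real)

lemma cinner_scaleR_left: "cinner (r *\<^sub>R x) y = r *\<^sub>R cinner x (y::'a::complex_hilbert_space)"
  by (metis cinner_scaleC_left scaleC_of_real scaleR_conv_of_real complex_cnj_complex_of_real)

lemma scaleC_one [simp]: "1 *\<^sub>C x = (x::'a::complex_hilbert_space)"
  using scaleC_of_real[of 1 x] by simp

lemma scaleC_minus_one: "(- 1) *\<^sub>C x = - (x::'a::complex_hilbert_space)"
  using scaleC_of_real[of "- 1" x] by simp

lemma scaleC_scaleR: "c *\<^sub>C (r *\<^sub>R x) = r *\<^sub>R (c *\<^sub>C (x::'a::complex_hilbert_space))"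
  by (metis scaleC_of_real scaleC_scaleC mult.commute)

lemma scaleR_scaleC: "(r *\<^sub>R c) *\<^sub>C x = r *\<^sub>R (c *\<^sub>C (x::'a::complex_hilbert_space))"
  by (metis scaleC_of_real scaleC_scaleC scaleR_conv_of_real)

lemma norm_scaleC: "norm (c *\<^sub>C x) = cmod c * norm (x::'a::complex_hilbert_space)"
proof -
  have "complex_of_real ((norm (c *\<^sub>C x))\<^sup>2) = complex_of_real ((cmod c * norm x)\<^sup>2)"
    unfolding cinner_norm[symmetric] cinner_scaleC_left cinner_scaleC_right
    by (simp add: cinner_norm power_mult_distrib mult.assoc[symmetric] complex_norm_square[symmetric]
        mult.commute)
  then have "(norm (c *\<^sub>C x))\<^sup>2 = (cmod c * norm x)\<^sup>2"
    using of_real_eq_iff by blast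
  then show ?thesis by (simp add: power2_eq_iff_nonneg)
qed

interpretation scaleC: bounded_bilinear "scaleC :: complex \<Rightarrow> 'a \<Rightarrow> 'a::complex_hilbert_space"
  by unfold_locales
    (auto simp: scaleC_add_left scaleC_add_right scaleC_scaleR scaleR_scaleC norm_scaleC intro!: exI[of _ 1])

lemma norm_add_square:
  "(norm (x + y))\<^sup>2 = (norm x)\<^sup>2 + (norm y)\<^sup>2 + 2 * Re (cinner x (y::'a::complex_hilbert_space))"
proof -
  have "complex_of_real ((norm (x + y))\<^sup>2) = cinner x x + cinner y y + (cinner x y + cnj (cinner x y))"
    unfolding cinner_norm[symmetric] cinner_add_left cinner_add_right
    using cinner_commute[of y x] by simp
  also have "\<dots> = complex_of_real ((norm x)\<^sup>2 + (norm y)\<^sup>2 + 2 * Re (cinner x y))"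
    by (simp add: cinner_norm complex_eq_iff)
  finally show ?thesis using of_real_eq_iff by blast
qed

text \<open>Pythagoras for the component of \<open>x\<close> orthogonal to \<open>y\<close>. It
  yields both the Cauchy-Schwarz inequality and the orthogonality of a best approximation.\<close>

lemma norm_minus_projection_square:
  fixes x y :: "'a::complex_hilbert_space"
  assumes "y \<noteq> 0"
  shows "(norm (x - (cinner y x / (norm y)\<^sup>2) *\<^sub>C y))\<^sup>2 = (norm x)\<^sup>2 - (cmod (cinner y x))\<^sup>2 / (norm y)\<^sup>2"
proof -
  define c where "c = - (cinner y x / (norm y)\<^sup>2)"
  have ny: "(norm y)\<^sup>2 \<noteq> 0" using assms by simp
  have "x - (cinner y x / (norm y)\<^sup>2) *\<^sub>C y = x + c *\<^sub>C y"
    by (simp add: c_def scaleC.minus_left)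
  then have "(norm (x - (cinner y x / (norm y)\<^sup>2) *\<^sub>C y))\<^sup>2
      = (norm x)\<^sup>2 + (cmod c * norm y)\<^sup>2 + 2 * Re (c * cinner x y)"
    by (simp only: norm_add_square norm_scaleC cinner_scaleC_right)
  moreover have "c * cinner x y = complex_of_real (- ((cmod (cinner y x))\<^sup>2 / (norm y)\<^sup>2))"
    using cinner_commute[of x y] by (simp add: c_def complex_norm_square[symmetric])
  moreover have "(cmod c * norm y)\<^sup>2 = (cmod (cinner y x))\<^sup>2 / (norm y)\<^sup>2"
    using ny by (simp add: c_def norm_divide norm_power power_mult_distrib power_divide field_simps)
  ultimately show ?thesis by simp
qed

lemma cinner_Cauchy_Schwarz: "cmod (cinner x y) \<le> norm x * norm (y::'a::complex_hilbert_space)"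
proof (cases "x = 0")
  case True
  have "cinner (0::'a) y = 0"
    using cinner_add_left[of 0 0 y] by simp
  then show ?thesis using True by simp
next
  case False
  then have "(norm x)\<^sup>2 > 0" by simp
  moreover have "0 \<le> (norm y)\<^sup>2 - (cmod (cinner x y))\<^sup>2 / (norm x)\<^sup>2"
    using norm_minus_projection_square[OF False, of y] by (metis zero_le_power2)
  ultimately have "(cmod (cinner x y))\<^sup>2 \<le> (norm x * norm y)\<^sup>2"
    by (simp add: field_simps power_mult_distrib)
  then show ?thesis by (rule power2_le_imp_le) simp
qed

interpretation cinner: bounded_bilinear "cinner :: 'a::complex_hilbert_space \<Rightarrow> 'a \<Rightarrow> complex"
  by unfold_locales
    (auto simp: cinner_add_left cinner_add_right cinner_scaleR_left cinner_scaleR_right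
      intro!: exI[of _ 1] cinner_Cauchy_Schwarz)

lemma cinner_self_eq_0_iff [simp]: "cinner x x = 0 \<longleftrightarrow> (x::'a::complex_hilbert_space) = 0"
  by (simp add: cinner_norm)

lemma cinner_eqI: "(\<And>z. cinner z x = cinner z y) \<Longrightarrow> x = (y::'a::complex_hilbert_space)"
  by (metis cinner.diff_right cinner_self_eq_0_iff eq_iff_diff_eq_0)

section \<open>Polarization, orthogonal decomposition and Riesz representation\<close>

lemma parallelogram_law:
  "(norm (x + y))\<^sup>2 + (norm (x - y))\<^sup>2 = 2 * (norm x)\<^sup>2 + 2 * (norm (y::'a::complex_hilbert_space))\<^sup>2"
  using norm_add_square[of x y] norm_add_square[of x "- y"] by (simp add: cinner.minus_right)

text \<open>Polarization: expanding at x + y gives one relation between the two mixed terms,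
  replacing y by \<i> y gives a second with the opposite sign. Complex scalars are essential: a
  rotation by a right angle of the real plane has zero quadratic form.\<close>

lemma quadratic_form_zero:
  fixes D :: "'a::complex_hilbert_space \<Rightarrow> 'a"
  assumes add: "\<And>x y. D (x + y) = D x + D y" and scale: "\<And>c x. D (c *\<^sub>C x) = c *\<^sub>C D x"
    and zero: "\<And>x. cinner x (D x) = 0"
  shows "D y = 0"
proof -
  have 1: "cinner x (D y) + cinner y (D x) = 0" for x y
    using zero[of "x + y"] zero[of x] zero[of y]
    by (simp add: add cinner_add_left cinner_add_right add.commute)
  have 2: "cinner x (D y) - cinner y (D x) = 0" for x y
    using 1[of x "\<i> *\<^sub>C y"] by (simp add: scale cinner_scaleC_left cinner_scaleC_right right_diff_distrib[symmetric])
  have "cinner x (D y) = 0" for x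
    using 1[of x y] 2[of x y] by simp
  then show ?thesis by (metis cinner_self_eq_0_iff)
qed

text \<open>The nearest point \<open>m\<close> of \<open>M\<close> exists because the parallelogram
  law makes every minimizing sequence Cauchy; minimality then forces x - m to be orthogonal to
  \<open>M\<close>.\<close>

lemma orthogonal_decomposition:
  fixes M :: "'a::complex_hilbert_space set"
  assumes cl: "closed M" and M0: "0 \<in> M"
    and add: "\<And>x y. x \<in> M \<Longrightarrow> y \<in> M \<Longrightarrow> x + y \<in> M"
    and scale: "\<And>c x. x \<in> M \<Longrightarrow> c *\<^sub>C x \<in> M"
  obtains m where "m \<in> M" "\<And>y. y \<in> M \<Longrightarrow> cinner y (x - m) = 0"
proof -
  define d where "d = (INF m\<in>M. (norm (x - m))\<^sup>2)"
  have bdd: "bdd_below ((\<lambda>m. (norm (x - m))\<^sup>2) ` M)"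
    by (rule bdd_belowI[of _ 0]) auto
  have d_le: "d \<le> (norm (x - m))\<^sup>2" if "m \<in> M" for m
    unfolding d_def by (rule cINF_lower[OF bdd that])
  have "\<exists>m\<in>M. (norm (x - m))\<^sup>2 < d + inverse (Suc n)" for n
  proof -
    have "(INF m\<in>M. (norm (x - m))\<^sup>2) < d + inverse (Suc n)" by (simp add: d_def)
    then show ?thesis using cINF_less_iff[OF _ bdd] M0 by blast
  qed
  then obtain f where fM: "\<And>n. f n \<in> M" and fd: "\<And>n. (norm (x - f n))\<^sup>2 < d + inverse (Suc n)"
    by metis
  have diff: "(norm (f m - f n))\<^sup>2 \<le> 2 * inverse (Suc m) + 2 * inverse (Suc n)" for m n
  proof -
    \<comment> \<open>The midpoint of two approximants lies in \<open>M\<close>, hence has squared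
      distance at least \<open>d\<close> from \<open>x\<close>. Put into the parallelogram law, this
      bounds the distance of the two approximants by their excess over \<open>d\<close>.\<close>
    define h where "h = complex_of_real (1/2) *\<^sub>C (f m + f n)"
    have "h \<in> M" unfolding h_def by (intro scale add fM)
    have "(x - f m) + (x - f n) = complex_of_real 2 *\<^sub>C (x - h)"
      unfolding h_def scaleC_of_real by (simp add: algebra_simps scaleR_2)
    then have "(norm ((x - f m) + (x - f n)))\<^sup>2 = 4 * (norm (x - h))\<^sup>2"
      by (simp add: norm_scaleC power_mult_distrib)
    moreover have "norm ((x - f m) - (x - f n)) = norm (f m - f n)"
      by (simp add: norm_minus_commute)
    ultimately show ?thesis
      using parallelogram_law[of "x - f m" "x - f n"] fd[of m] fd[of n] d_le[OF \<open>h \<in> M\<close>] by simp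
  qed
  have "Cauchy f"
  proof (rule metric_CauchyI)
    fix e :: real assume "e > 0"
    then obtain N where N: "inverse (real (Suc N)) < e\<^sup>2 / 4"
      using reals_Archimedean[of "e\<^sup>2 / 4"] by auto
    have "dist (f m) (f n) < e" if "m \<ge> N" "n \<ge> N" for m n
    proof -
      have "inverse (real (Suc m)) \<le> inverse (real (Suc N))" "inverse (real (Suc n)) \<le> inverse (real (Suc N))"
        using that by (auto intro!: le_imp_inverse_le)
      then have "(norm (f m - f n))\<^sup>2 < e\<^sup>2" using diff[of m n] N by linarith
      then show ?thesis using \<open>e > 0\<close> by (simp add: dist_norm power2_less_imp_less)
    qed
    then show "\<exists>M. \<forall>m\<ge>M. \<forall>n\<ge>M. dist (f m) (f n) < e" by blast
  qed
  then obtain m where m: "f \<longlonglongrightarrow> m" using Cauchy_convergent_iff convergent_def by blast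
  have mM: "m \<in> M" using closed_sequentially[OF cl fM m] .
  have l1: "(\<lambda>n. d + inverse (Suc n)) \<longlonglongrightarrow> d + 0"
    by (intro tendsto_intros LIMSEQ_inverse_real_of_nat)
  have l2: "(\<lambda>n. (norm (x - f n))\<^sup>2) \<longlonglongrightarrow> (norm (x - m))\<^sup>2"
    by (intro tendsto_intros m)
  have "(norm (x - m))\<^sup>2 \<le> d + 0"
    using LIMSEQ_le[OF l2 l1] fd less_imp_le by blast
  then have min: "(norm (x - m))\<^sup>2 \<le> d" by simp
  have "cinner y (x - m) = 0" if "y \<in> M" for y
  proof (cases "y = 0")
    case False
    \<comment> \<open>Moving \<open>m\<close> by the projection of x - m onto \<open>y\<close> would
      bring it closer to \<open>x\<close> than \<open>d\<close> allows, unless that projection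
      vanishes.\<close>
    let ?c = "cinner y (x - m) / (norm y)\<^sup>2"
    have "d \<le> (norm (x - (m + ?c *\<^sub>C y)))\<^sup>2" by (intro d_le add mM scale that)
    also have "x - (m + ?c *\<^sub>C y) = (x - m) - ?c *\<^sub>C y" by simp
    finally have "(cmod (cinner y (x - m)))\<^sup>2 / (norm y)\<^sup>2 \<le> 0"
      using norm_minus_projection_square[OF False, of "x - m"] min by simp
    then show ?thesis using False by (simp add: divide_le_0_iff)
  qed (simp add: cinner.zero_left)
  with mM show ?thesis using that by blast
qed

text \<open>The kernel of a nonzero functional has codimension one. A vector \<open>w\<close>
  orthogonal to it therefore represents the functional after scaling, because subtracting the right
  multiple of \<open>w\<close> puts any \<open>x\<close> into the kernel.\<close>

lemma Riesz_representation:
  fixes \<phi> :: "'a::complex_hilbert_space \<Rightarrow> complex"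
  assumes \<phi>_add: "\<And>x y. \<phi> (x + y) = \<phi> x + \<phi> y" and \<phi>_scale: "\<And>c x. \<phi> (c *\<^sub>C x) = c * \<phi> x"
    and bound: "\<And>x. cmod (\<phi> x) \<le> K * norm x"
  obtains z where "\<And>x. \<phi> x = cinner z x"
proof (cases "\<forall>x. \<phi> x = 0")
  case True
  then show ?thesis using that[of 0] by (simp add: cinner.zero_left)
next
  case False
  then obtain x0 where x0: "\<phi> x0 \<noteq> 0" by blast
  have bl: "bounded_linear \<phi>"
    using \<phi>_scale[of "complex_of_real _"] bound
    by (intro bounded_linear_intro[of _ K]) (auto simp: \<phi>_add scaleC_of_real scaleR_conv_of_real mult.commute)
  interpret bounded_linear \<phi> by (rule bl)
  let ?M = "{x. \<phi> x = 0}"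
  have "closed ?M"
    by (intro closed_Collect_eq linear_continuous_on bl continuous_on_const)
  then obtain m where m: "\<phi> m = 0" "\<And>y. \<phi> y = 0 \<Longrightarrow> cinner y (x0 - m) = 0"
    by (rule orthogonal_decomposition[of ?M x0]) (auto simp: \<phi>_add \<phi>_scale zero)
  define w where "w = x0 - m"
  have w: "\<phi> w \<noteq> 0" using x0 m(1) by (simp add: w_def diff)
  then have wn: "complex_of_real ((norm w)\<^sup>2) \<noteq> 0" using zero by auto
  show ?thesis
  proof (rule that)
    fix x
    have "\<phi> (x - (\<phi> x / \<phi> w) *\<^sub>C w) = 0" using w by (simp add: diff \<phi>_scale)
    then have "cinner (x - (\<phi> x / \<phi> w) *\<^sub>C w) w = 0" using m(2) by (simp add: w_def)
    then have "cinner w (x - (\<phi> x / \<phi> w) *\<^sub>C w) = 0" by (metis cinner_commute complex_cnj_zero)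
    then have "cinner w x = \<phi> x / \<phi> w * complex_of_real ((norm w)\<^sup>2)"
      by (simp add: cinner.diff_right cinner_scaleC_right cinner_norm)
    then have "\<phi> x = \<phi> w / complex_of_real ((norm w)\<^sup>2) * cinner w x" using w wn by (simp add: field_simps)
    then show "\<phi> x = cinner (cnj (\<phi> w / complex_of_real ((norm w)\<^sup>2)) *\<^sub>C w) x"
      by (simp add: cinner_scaleC_left)
  qed
qed

section \<open>Bounded operators, adjoints and commutants\<close>

lemma bounded_opsI:
  "(\<And>x y. T (x + y) = T x + T y) \<Longrightarrow> (\<And>c x. T (c *\<^sub>C x) = c *\<^sub>C T x) \<Longrightarrow>
    (\<And>x. norm (T x) \<le> K * norm x) \<Longrightarrow> T \<in> bounded_ops"
  by (auto simp: bounded_ops_def)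

lemma bounded_ops_add: "T \<in> bounded_ops \<Longrightarrow> T (x + y) = T x + T y"
  and bounded_ops_scaleC: "T \<in> bounded_ops \<Longrightarrow> T (c *\<^sub>C x) = c *\<^sub>C T x"
  by (auto simp: bounded_ops_def)

lemma bounded_ops_bounded_linear: "T \<in> bounded_ops \<Longrightarrow> bounded_linear T"
  unfolding bounded_ops_def
  by clarify (rule bounded_linear_intro, auto simp: mult.commute[of "norm _"] scaleC_of_real[symmetric])

lemma id_bounded_ops: "id \<in> bounded_ops"
  by (rule bounded_opsI[where K = 1]) auto

lemma bounded_ops_plus: 
  assumes "S \<in> bounded_ops" "T \<in> bounded_ops" shows "(\<lambda>x. S x + T x) \<in> bounded_ops"
proof -
  obtain K L where "\<And>x. norm (S x) \<le> K * norm x" "\<And>x. norm (T x) \<le> L * norm x"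
    using assms by (auto simp: bounded_ops_def)
  then have "norm (S x + T x) \<le> (K + L) * norm x" for x
    by (metis add_mono distrib_right norm_triangle_mono)
  then show ?thesis using assms
    by (intro bounded_opsI) (auto simp: bounded_ops_add bounded_ops_scaleC scaleC_add_right)
qed

lemma bounded_ops_scale: 
  assumes "T \<in> bounded_ops" shows "(\<lambda>x. c *\<^sub>C T x) \<in> bounded_ops"
proof -
  obtain K where "\<And>x. norm (T x) \<le> K * norm x"
    using assms by (auto simp: bounded_ops_def)
  then have "norm (c *\<^sub>C T x) \<le> (cmod c * K) * norm x" for x
    by (simp add: norm_scaleC mult_left_mono mult.assoc)
  then show ?thesis using assms
    by (intro bounded_opsI[where K = "cmod c * K"])
      (auto simp: bounded_ops_add bounded_ops_scaleC scaleC_add_right scaleC_scaleC mult.commute[of c])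
qed

lemma bounded_ops_comp: 
  assumes "S \<in> bounded_ops" "T \<in> bounded_ops" shows "S \<circ> T \<in> bounded_ops"
proof -
  have "bounded_linear (S \<circ> T)"
    using assms bounded_ops_bounded_linear bounded_linear_compose unfolding comp_def by blast
  then obtain K where "\<And>x. norm ((S \<circ> T) x) \<le> norm x * K"
    using bounded_linear.bounded by blast
  then show ?thesis using assms
    by (intro bounded_opsI) (auto simp: bounded_ops_add bounded_ops_scaleC mult.commute)
qed

lemma bounded_ops_power: "T \<in> bounded_ops \<Longrightarrow> T ^^ n \<in> bounded_ops"
  by (induction n) (auto simp: id_bounded_ops bounded_ops_comp)

lemma bounded_ops_eqI:
  assumes "S \<in> bounded_ops" "T \<in> bounded_ops" "\<And>x. cinner x (S x) = cinner x (T x)"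
  shows "S = T"
proof
  fix x
  have "S x - T x = 0"
    using assms by (intro quadratic_form_zero[of "\<lambda>x. S x - T x"])
      (auto simp: bounded_ops_add bounded_ops_scaleC scaleC.diff_right cinner.diff_right)
  then show "S x = T x" by simp
qed

lemma cinner_bounded_adjoint:
  assumes T: "T \<in> bounded_ops"
  shows "cinner (T x) y = cinner x (bounded_adjoint T y)"
proof -
  obtain K where K: "\<And>x. norm (T x) \<le> K * norm x" using T by (auto simp: bounded_ops_def)
  have bnd: "cmod (cinner y (T x)) \<le> (norm y * K) * norm x" for x
    using cinner_Cauchy_Schwarz[of y "T x"] mult_left_mono[OF K[of x] norm_ge_zero[of y]]
    by (simp add: mult.assoc)
  obtain z where "\<And>x. cinner y (T x) = cinner z x"
    by (rule Riesz_representation[of "\<lambda>x. cinner y (T x)" "norm y * K"])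
      (auto simp: bounded_ops_add[OF T] bounded_ops_scaleC[OF T] cinner_add_right cinner_scaleC_right bnd)
  then have z: "\<forall>x. cinner (T x) y = cinner x z" by (metis cinner_commute)
  then have "bounded_adjoint T y = z"
    unfolding bounded_adjoint_def by (intro the_equality) (auto intro: cinner_eqI)
  then show ?thesis using z by simp
qed

lemma bounded_adjoint_eqI:
  assumes "\<And>x y. cinner (T x) y = cinner x (S y)"
  shows "bounded_adjoint T = S"
  unfolding bounded_adjoint_def using assms by (auto intro!: ext the_equality intro: cinner_eqI)

lemma bounded_adjoint_bounded_ops:
  assumes T: "T \<in> bounded_ops"
  shows "bounded_adjoint T \<in> bounded_ops"
proof -
  note adj = cinner_bounded_adjoint[OF T, symmetric]
  obtain K where K: "\<And>x. norm (T x) \<le> K * norm x" using T by (auto simp: bounded_ops_def)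
  show ?thesis
  proof (rule bounded_opsI)
    show "bounded_adjoint T (x + y) = bounded_adjoint T x + bounded_adjoint T y" for x y
      by (rule cinner_eqI) (simp add: adj cinner_add_right)
    show "bounded_adjoint T (c *\<^sub>C x) = c *\<^sub>C bounded_adjoint T x" for c x
      by (rule cinner_eqI) (simp add: adj cinner_scaleC_right)
    fix x
    let ?z = "bounded_adjoint T x"
    \<comment> \<open>Pairing the value \<open>?z\<close> of the adjoint with itself bounds its
      square by K |?z| |x|; one factor |?z| cancels.\<close>
    have "(norm ?z)\<^sup>2 = cmod (cinner ?z ?z)" by (simp add: cinner_norm norm_power)
    also have "\<dots> = cmod (cinner (T ?z) x)" by (simp add: adj)
    also have "\<dots> \<le> norm (T ?z) * norm x" by (rule cinner_Cauchy_Schwarz)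
    also have "\<dots> \<le> K * norm ?z * norm x" by (intro mult_right_mono K) simp
    finally have "norm ?z * norm ?z \<le> norm ?z * (K * norm x)" by (simp add: power2_eq_square ac_simps)
    moreover have "0 \<le> K * norm x" using K[of x] norm_ge_zero order_trans by blast
    ultimately show "norm ?z \<le> K * norm x" by (cases "norm ?z = 0") auto
  qed
qed

section \<open>Commutants and generated von Neumann algebras\<close>

lemma commutant_antimono: "S \<subseteq> T \<Longrightarrow> commutant T \<subseteq> commutant S"
  by (auto simp: commutant_def)

lemma subset_double_commutant: "S \<subseteq> bounded_ops \<Longrightarrow> S \<subseteq> commutant (commutant S)"
  by (fastforce simp: commutant_def)

lemma triple_commutant: 
  assumes "S \<subseteq> bounded_ops" shows "commutant (commutant (commutant S)) = commutant S"
proof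
  show "commutant (commutant (commutant S)) \<subseteq> commutant S"
    by (intro commutant_antimono subset_double_commutant assms)
  show "commutant S \<subseteq> commutant (commutant (commutant S))"
    by (rule subset_double_commutant) (auto simp: commutant_def)
qed

text \<open>Taking adjoints of \<open>T A* = A* T\<close> turns it into a commutation relation for
  the adjoint of \<open>T\<close>. Applied to \<open>S\<close> and then to its commutant, this makes
  the double commutant closed under adjoints.\<close>

lemma bounded_adjoint_commutant:
  assumes S: "S \<subseteq> bounded_ops" and adj: "\<And>A. A \<in> S \<Longrightarrow> bounded_adjoint A \<in> S"
    and T: "T \<in> commutant S"
  shows "bounded_adjoint T \<in> commutant S"
proof -
  have Tb: "T \<in> bounded_ops" using T by (simp add: commutant_def)
  have "bounded_adjoint T (A x) = A (bounded_adjoint T x)" if A: "A \<in> S" for A x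
  proof (rule cinner_eqI)
    fix z
    have Ab: "A \<in> bounded_ops" and A'b: "bounded_adjoint A \<in> bounded_ops" using A S adj by auto
    have AA: "cinner (bounded_adjoint A u) v = cinner u (A v)" for u v
      using cinner_bounded_adjoint[OF Ab, of v u] cinner_commute[of "bounded_adjoint A u" v]
        cinner_commute[of u "A v"] by simp
    have "T \<circ> bounded_adjoint A = bounded_adjoint A \<circ> T"
      using T adj[OF A] by (auto simp: commutant_def)
    then have comm: "T (bounded_adjoint A z) = bounded_adjoint A (T z)"
      by (simp add: fun_eq_iff)
    have "cinner z (bounded_adjoint T (A x)) = cinner (T z) (A x)"
      by (simp add: cinner_bounded_adjoint[OF Tb])
    also have "\<dots> = cinner (T (bounded_adjoint A z)) x" by (simp add: AA comm)
    also have "\<dots> = cinner z (A (bounded_adjoint T x))"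
      by (simp add: cinner_bounded_adjoint[OF Tb] AA)
    finally show "cinner z (bounded_adjoint T (A x)) = cinner z (A (bounded_adjoint T x))" .
  qed
  then show ?thesis
    using bounded_adjoint_bounded_ops[OF Tb] by (auto simp: commutant_def)
qed

lemma von_neumann_algebra_double_commutant:
  assumes S: "S \<subseteq> bounded_ops" and adj: "\<And>A. A \<in> S \<Longrightarrow> bounded_adjoint A \<in> S"
  shows "von_neumann_algebra (commutant (commutant S))"
proof -
  let ?C = "commutant S"
  have C: "?C \<subseteq> bounded_ops" by (auto simp: commutant_def)
  have lin: "(\<lambda>x. A x + B x) \<in> commutant ?C" "(\<lambda>x. c *\<^sub>C A x) \<in> commutant ?C" "A \<circ> B \<in> commutant ?C"
    if "A \<in> commutant ?C" "B \<in> commutant ?C" for A B c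
    using that C
    by (auto simp: commutant_def[of ?C] bounded_ops_plus bounded_ops_scale bounded_ops_comp fun_eq_iff
        bounded_ops_add bounded_ops_scaleC subset_iff)
  have adjC: "bounded_adjoint A \<in> ?C" if "A \<in> ?C" for A
    using bounded_adjoint_commutant[OF S adj that] .
  show ?thesis
    unfolding von_neumann_algebra_def
    using lin bounded_adjoint_commutant[OF C adjC] triple_commutant[OF S]
    by (auto simp: commutant_def[of ?C] id_bounded_ops)
qed

text \<open>The double commutant of a self-adjoint set is a von Neumann algebra containing it.
  Conversely, a von Neumann algebra containing \<open>S\<close> equals its own double commutant and
  so contains that of \<open>S\<close>.\<close>

lemma von_neumann_generated_eq:
  assumes S: "S \<subseteq> bounded_ops" and adj: "\<And>A. A \<in> S \<Longrightarrow> bounded_adjoint A \<in> S"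
  shows "von_neumann_generated S = commutant (commutant S)"
proof
  show "von_neumann_generated S \<subseteq> commutant (commutant S)"
    unfolding von_neumann_generated_def
    using von_neumann_algebra_double_commutant[OF assms] subset_double_commutant[OF S] by blast
  show "commutant (commutant S) \<subseteq> von_neumann_generated S"
    unfolding von_neumann_generated_def
  proof (intro Inter_greatest, clarify)
    fix M T assume M: "von_neumann_algebra M" "S \<subseteq> M" and T: "T \<in> commutant (commutant S)"
    have "commutant (commutant S) \<subseteq> commutant (commutant M)"
      by (intro commutant_antimono M(2))
    then show "T \<in> M" using M(1) T by (auto simp: von_neumann_algebra_def)
  qed
qed

section \<open>Algebras of functions closed under bounded pointwise limits\<close>

text \<open>The typical instance consists of the functions whose operators commute with a fixed
  bounded \<open>A\<close>. Conjugation is not a closure property, since commuting with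
  \<open>T\<close> does not immediately yield commuting with its adjoint. The bound in
  \<open>lim\<close> is uniform in both arguments, as dominated convergence over finite measures
  wants it.\<close>

locale bounded_limit_algebra =
  fixes D :: "(real \<Rightarrow> complex) set"
  assumes const: "(\<lambda>_. c) \<in> D"
    and add: "f \<in> D \<Longrightarrow> g \<in> D \<Longrightarrow> (\<lambda>l. f l + g l) \<in> D"
    and mult: "f \<in> D \<Longrightarrow> g \<in> D \<Longrightarrow> (\<lambda>l. f l * g l) \<in> D"
    and lim: "(\<And>n::nat. F n \<in> D) \<Longrightarrow> (\<And>n l. cmod (F n l) \<le> K) \<Longrightarrow>
      (\<And>l. (\<lambda>n. F n l) \<longlonglongrightarrow> f l) \<Longrightarrow> f \<in> D"

lemma (in bounded_limit_algebra) diff: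
  "f \<in> D \<Longrightarrow> g \<in> D \<Longrightarrow> (\<lambda>l. f l - g l) \<in> D"
  using add[OF _ mult[OF const[of "- 1"]], of f g] by simp

lemma (in bounded_limit_algebra) sum:
  "(\<And>i. i \<in> I \<Longrightarrow> f i \<in> D) \<Longrightarrow> (\<lambda>l. \<Sum>i\<in>I. f i l) \<in> D"
  by (induction I rule: infinite_finite_induct) (auto intro: const add)

lemma (in bounded_limit_algebra) prod:
  "(\<And>i. i \<in> I \<Longrightarrow> f i \<in> D) \<Longrightarrow> (\<lambda>l. \<Prod>i\<in>I. f i l) \<in> D"
  by (induction I rule: infinite_finite_induct) (auto intro: const mult)

text \<open>Polynomials in \<open>s\<close> stay in the algebra, and Weierstrass approximation on
  [-K, K], which contains all values of \<open>s\<close>, gives uniform convergence to h(s).\<close>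

lemma (in bounded_limit_algebra) continuous_comp:
  fixes s h :: "real \<Rightarrow> real"
  assumes s: "(\<lambda>l. complex_of_real (s l)) \<in> D" and bound: "\<And>l. \<bar>s l\<bar> \<le> K"
    and h: "continuous_on UNIV h"
  shows "(\<lambda>l. complex_of_real (h (s l))) \<in> D"
proof -
  have cont: "continuous_on {-K..K} h" using h continuous_on_subset by blast
  have "\<exists>g. real_polynomial_function g \<and> (\<forall>x\<in>{-K..K}. \<bar>h x - g x\<bar> < inverse (Suc n))" for n
  proof -
    have "0 < inverse (real (Suc n))" by simp
    from Stone_Weierstrass_real_polynomial_function[OF compact_Icc cont this] show ?thesis by metis
  qed
  then obtain g where "\<forall>n. real_polynomial_function (g n) \<and> (\<forall>x\<in>{-K..K}. \<bar>h x - g n x\<bar> < inverse (Suc n))"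
    by (elim choice[OF allI, THEN exE])
  then have g: "\<And>n. real_polynomial_function (g n)"
    and approx: "\<And>n x. x \<in> {-K..K} \<Longrightarrow> \<bar>h x - g n x\<bar> < inverse (Suc n)"
    by blast+
  have poly: "(\<lambda>l. complex_of_real (p (s l))) \<in> D" if "real_polynomial_function p" for p
    using that
  proof induction
    case (linear p)
    have "p (s l) = s l * p 1" for l
      using linear_scale[OF bounded_linear.linear[OF linear], of "s l" 1] by simp
    then have "(\<lambda>l. complex_of_real (p (s l))) = (\<lambda>l. complex_of_real (s l) * complex_of_real (p 1))"
      by (simp only: of_real_mult)
    then show ?case using mult[OF s const, of "complex_of_real (p 1)"] by (simp only:)
  next
    case (const c)
    show ?case by (rule bounded_limit_algebra.const[OF bounded_limit_algebra_axioms])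
  next
    case (add p q)
    then show ?case
      using bounded_limit_algebra.add[OF bounded_limit_algebra_axioms add.IH] by (simp only: of_real_add)
  next
    case (mult p q)
    then show ?case
      using bounded_limit_algebra.mult[OF bounded_limit_algebra_axioms mult.IH] by (simp only: of_real_mult)
  qed
  have sK: "s l \<in> {-K..K}" for l using bound[of l] by auto
  obtain B where "\<forall>y\<in>h ` {-K..K}. norm y \<le> B"
    using compact_imp_bounded[OF compact_continuous_image[OF cont compact_Icc]]
    unfolding bounded_iff by (elim exE)
  then have B: "\<bar>h x\<bar> \<le> B" if "x \<in> {-K..K}" for x
    using that by simp
  show ?thesis
  proof (rule lim)
    show "(\<lambda>l. complex_of_real (g n (s l))) \<in> D" for n by (rule poly[OF g])
    show "cmod (complex_of_real (g n (s l))) \<le> B + 1" for n l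
    proof -
      have "inverse (real (Suc n)) \<le> 1" by (simp add: field_simps)
      then show ?thesis using approx[OF sK[of l], of n] B[OF sK[of l]] by simp
    qed
    show "(\<lambda>n. complex_of_real (g n (s l))) \<longlonglongrightarrow> complex_of_real (h (s l))" for l
    proof (rule tendsto_of_real, rule LIM_zero_cancel)
      show "(\<lambda>n. g n (s l) - h (s l)) \<longlonglongrightarrow> 0"
      proof (rule Lim_null_comparison[OF _ LIMSEQ_inverse_real_of_nat])
        have "norm (g n (s l) - h (s l)) \<le> inverse (real (Suc n))" for n
          using approx[OF sK[of l], of n] by simp
        then show "\<forall>\<^sub>F n in sequentially. norm (g n (s l) - h (s l)) \<le> inverse (real (Suc n))"
          by (intro always_eventually allI)
      qed
    qed
  qed
qed

text \<open>The identity function is unbounded and cannot be reached by a bounded limit. Its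
  approximations \<open>s n\<close> are therefore never passed to the limit themselves, only under a
  bounded continuous \<open>h\<close>.\<close>

lemma (in bounded_limit_algebra) bounded_continuous:
  fixes s :: "nat \<Rightarrow> real \<Rightarrow> real"
  assumes s: "\<And>n. (\<lambda>l. complex_of_real (s n l)) \<in> D" and bound: "\<And>n l. \<bar>s n l\<bar> \<le> K n"
    and s_lim: "\<And>l. (\<lambda>n. s n l) \<longlonglongrightarrow> l"
    and h: "continuous_on UNIV h" and hB: "\<And>l. \<bar>h l\<bar> \<le> B"
  shows "(\<lambda>l. complex_of_real (h l)) \<in> D"
proof (rule lim)
  show "(\<lambda>l. complex_of_real (h (s n l))) \<in> D" for n
    by (rule continuous_comp[OF s bound h])
  show "cmod (complex_of_real (h (s n l))) \<le> B" for n l using hB by simp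
  show "(\<lambda>n. complex_of_real (h (s n l))) \<longlonglongrightarrow> complex_of_real (h l)" for l
    using h s_lim[of l] by (intro tendsto_of_real isCont_tendsto_compose[of l h])
      (auto simp: continuous_on_eq_continuous_at)
qed

lemma (in bounded_limit_algebra) indicator_mem:
  fixes s :: "nat \<Rightarrow> real \<Rightarrow> real"
  assumes s: "\<And>n. (\<lambda>l. complex_of_real (s n l)) \<in> D" and bound: "\<And>n l. \<bar>s n l\<bar> \<le> K n"
    and s_lim: "\<And>l. (\<lambda>n. s n l) \<longlonglongrightarrow> l" and B: "B \<in> sets borel"
  shows "(\<lambda>l. indicator B l) \<in> D"
proof -
  have ray: "(\<lambda>l. indicator {..a} l) \<in> D" for a :: real
  proof (rule lim)
    \<comment> \<open>For n > 0 this is 1 up to \<open>a\<close> and descends linearly to 0 at a +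
      1/n.\<close>
    let ?h = "\<lambda>n l. max 0 (min 1 (1 - real n * (l - a)))"
    show "(\<lambda>l. complex_of_real (?h n l)) \<in> D" for n
      by (rule bounded_continuous[OF s bound s_lim, where B = 1]) (auto intro!: continuous_intros)
    show "cmod (complex_of_real (?h n l)) \<le> 1" for n l by simp
    show "(\<lambda>n. complex_of_real (?h n l)) \<longlonglongrightarrow> indicator {..a} l" for l
    proof (cases "l \<le> a")
      case True
      then have "?h n l = 1" for n by (simp add: mult_nonneg_nonpos)
      then show ?thesis using True by simp
    next
      case False
      then obtain N where N: "1 < real N * (l - a)" using reals_Archimedean3[of "l - a"] by auto
      have "?h n l = 0" if "n \<ge> N" for n
      proof -
        have "real N * (l - a) \<le> real n * (l - a)" using that False by (intro mult_right_mono) auto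
        then show ?thesis using N by simp
      qed
      then have "eventually (\<lambda>n. complex_of_real (?h n l) = 0) sequentially"
        unfolding eventually_sequentially by (metis of_real_0)
      from tendsto_eventually[OF this] show ?thesis using False by simp
    qed
  qed
  have "B \<in> sigma_sets UNIV (range atMost)"
    using B by (simp add: borel_eq_atMost)
  then show ?thesis
  proof induction
    case (Basic A)
    then show ?case using ray by auto
  next
    case Empty
    then show ?case using const[of 0] by simp
  next
    case (Compl A)
    have "(\<lambda>l. indicator (UNIV - A) l :: complex) = (\<lambda>l. 1 - indicator A l)"
      by (auto simp: indicator_def)
    then show ?case using diff[OF const Compl(2)] by simp
  next
    case (Union A)
    show ?case
    proof (rule lim)
      \<comment> \<open>The sets need not be disjoint, so the indicator of a finite union is written
        through the product of the complementary indicators.\<close>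
      let ?f = "\<lambda>n l. 1 - (\<Prod>i<n. 1 - indicator (A i) l) :: complex"
      show "?f n \<in> D" for n by (intro diff const prod Union)
      have val: "?f n l = (if \<exists>i<n. l \<in> A i then 1 else 0)" for n l
      proof (cases "\<exists>i<n. l \<in> A i")
        case True
        then have "(\<Prod>i<n. 1 - indicator (A i) l :: complex) = 0"
          by (intro prod_zero) (auto simp: indicator_def)
        then show ?thesis using True by simp
      next
        case False
        then have "(\<Prod>i<n. 1 - indicator (A i) l :: complex) = 1" by (intro prod.neutral) auto
        then show ?thesis using False by simp
      qed
      show "cmod (?f n l) \<le> 1" for n l unfolding val by simp
      show "(\<lambda>n. ?f n l) \<longlonglongrightarrow> indicator (\<Union> (range A)) l" for l
      proof (cases "l \<in> \<Union> (range A)")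
        case True
        then obtain i where "l \<in> A i" by auto
        then have "\<exists>j<n. l \<in> A j" if "n \<ge> Suc i" for n
          using that by (intro exI[of _ i]) simp
        then have "?f n l = 1" if "n \<ge> Suc i" for n unfolding val using that by presburger
        then have ev: "eventually (\<lambda>n. ?f n l = 1) sequentially"
          unfolding eventually_sequentially by blast
        have "indicator (\<Union> (range A)) l = (1::complex)" using True by (rule indicator_simps)
        then show ?thesis using tendsto_eventually[OF ev] by (simp only:)
      next
        case False
        then show ?thesis unfolding val by simp
      qed
    qed
  qed
qed

text \<open>Simple functions converging pointwise to \<open>f\<close> can be chosen with modulus at
  most twice that of \<open>f\<close>; this is where the uniform bound 2 K comes from.\<close>

lemma (in bounded_limit_algebra) bounded_measurable:
  assumes ind: "\<And>B. B \<in> sets borel \<Longrightarrow> (\<lambda>l. indicator B l) \<in> D"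
    and f: "f \<in> borel_measurable borel" and bound: "\<And>l. cmod (f l) \<le> K"
  shows "f \<in> D"
proof -
  obtain F where F: "\<And>i. simple_function borel (F i)"
    and lim': "\<And>x. (\<lambda>i. F i x) \<longlonglongrightarrow> f x"
    and bd: "\<And>i x. dist (F i x) 0 \<le> 2 * dist (f x) 0"
    using borel_measurable_implies_sequence_metric[OF f, of 0] by auto
  show ?thesis
  proof (rule lim)
    fix n
    have fin: "finite (range (F n))" using simple_functionD(1)[OF F[of n]] by simp
    have eq: "F n = (\<lambda>l. \<Sum>y\<in>range (F n). y * indicator (F n -` {y}) l)"
    proof
      fix l
      have "(\<Sum>y\<in>range (F n). y * indicator (F n -` {y}) l) = (\<Sum>y\<in>range (F n). if F n l = y then y else 0)"
        by (intro sum.cong) (auto simp: indicator_def)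
      also have "\<dots> = F n l" using fin by simp
      finally show "F n l = (\<Sum>y\<in>range (F n). y * indicator (F n -` {y}) l)" ..
    qed
    have "(\<lambda>l. \<Sum>y\<in>range (F n). y * indicator (F n -` {y}) l) \<in> D"
      using simple_functionD(2)[OF F[of n]] by (intro sum mult const ind) simp
    then show "F n \<in> D" using eq by simp
    show "cmod (F n l) \<le> 2 * K" for l
      using bd[of n l] bound[of l] by simp
  qed (rule lim')
qed

section \<open>Operator calculus generated by a multiplicative family\<close>

text \<open>A triple \<open>base f T S\<close> says that \<open>T\<close> represents \<open>f\<close> and has adjoint \<open>S\<close>. Keeping the
  adjoint in the triple is essential: strong limits do not commute with adjoints, so
  the limit rule below asks for strong convergence of both components.\<close>

locale operator_calculus =
  fixes \<mu> :: "'a::complex_hilbert_space \<Rightarrow> real measure"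
    and base :: "(real \<Rightarrow> complex) \<Rightarrow> ('a \<Rightarrow> 'a) \<Rightarrow> ('a \<Rightarrow> 'a) \<Rightarrow> bool"
  assumes finite_\<mu>: "finite_measure (\<mu> x)" and sets_\<mu>: "sets (\<mu> x) = sets borel"
    and base_measurable: "base f T S \<Longrightarrow> f \<in> borel_measurable borel"
    and base_bounded: "base f T S \<Longrightarrow> \<exists>K. \<forall>l. cmod (f l) \<le> K"
    and base_bounded_ops: "base f T S \<Longrightarrow> T \<in> bounded_ops"
    and base_adjoint: "base f T S \<Longrightarrow> cinner (T x) y = cinner x (S y)"
    and base_form: "base f T S \<Longrightarrow> cinner x (T x) = (LINT l|\<mu> x. f l)"
    and base_one: "base (\<lambda>_. 1) id id"
    and base_cnj: "base f T S \<Longrightarrow> base (\<lambda>l. cnj (f l)) S T"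
    and base_mult: "base f T S \<Longrightarrow> base g T' S' \<Longrightarrow> base (\<lambda>l. f l * g l) (T \<circ> T') (S' \<circ> S)"
begin

text \<open>There is no rule for products: multiplicativity is assumed of the basic triples only and
  is propagated through sums, multiples and limits by two inductions, one per factor.\<close>

inductive calc :: "(real \<Rightarrow> complex) \<Rightarrow> ('a \<Rightarrow> 'a) \<Rightarrow> ('a \<Rightarrow> 'a) \<Rightarrow> bool" where
  base: "base f T S \<Longrightarrow> calc f T S"
| add: "calc f T S \<Longrightarrow> calc g T' S' \<Longrightarrow> calc (\<lambda>l. f l + g l) (\<lambda>x. T x + T' x) (\<lambda>x. S x + S' x)"
| scale: "calc f T S \<Longrightarrow> calc (\<lambda>l. c * f l) (\<lambda>x. c *\<^sub>C T x) (\<lambda>x. cnj c *\<^sub>C S x)"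
| lim: "(\<And>n::nat. calc (F n) (P n) (Q n)) \<Longrightarrow> (\<And>n l. cmod (F n l) \<le> K) \<Longrightarrow>
    (\<And>l. (\<lambda>n. F n l) \<longlonglongrightarrow> f l) \<Longrightarrow> (\<And>x. (\<lambda>n. P n x) \<longlonglongrightarrow> T x) \<Longrightarrow> (\<And>x. (\<lambda>n. Q n x) \<longlonglongrightarrow> S x) \<Longrightarrow>
    T \<in> bounded_ops \<Longrightarrow> S \<in> bounded_ops \<Longrightarrow> calc f T S"

end

lemma (in operator_calculus) space_\<mu> [simp]: "space (\<mu> x) = UNIV"
  using sets_eq_imp_space_eq[OF sets_\<mu>] by simp

lemma (in operator_calculus) measurable_\<mu>: "f \<in> borel_measurable borel \<Longrightarrow> f \<in> borel_measurable (\<mu> x)"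
  using measurable_cong_sets[OF sets_\<mu> refl] by blast

lemma (in operator_calculus) integrable_bounded:
  fixes f :: "real \<Rightarrow> 'b::{banach, second_countable_topology}"
  assumes "f \<in> borel_measurable borel" "\<And>l. norm (f l) \<le> K"
  shows "integrable (\<mu> x) f"
  using assms by (intro finite_measure.integrable_const_bound[OF finite_\<mu>, of _ K] measurable_\<mu>) auto

lemma (in operator_calculus) calc_measurable: "calc f T S \<Longrightarrow> f \<in> borel_measurable borel"
proof (induction rule: calc.induct)
  case (lim F P Q K f T S)
  then show ?case using borel_measurable_LIMSEQ_metric[of F borel f] by blast
qed (auto intro: base_measurable)

lemma (in operator_calculus) calc_bounded: "calc f T S \<Longrightarrow> \<exists>K. \<forall>l. cmod (f l) \<le> K"
proof (induction rule: calc.induct)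
  case (add f T S g T' S')
  then obtain K L where "\<And>l. cmod (f l) \<le> K" "\<And>l. cmod (g l) \<le> L" by blast
  then have "cmod (f l + g l) \<le> K + L" for l by (meson add_mono norm_triangle_mono)
  then show ?case by blast
next
  case (scale f T S c)
  then obtain K where "\<And>l. cmod (f l) \<le> K" by blast
  then have "cmod (c * f l) \<le> cmod c * K" for l by (simp add: norm_mult mult_left_mono)
  then show ?case by blast
next
  case (lim F P Q K f T S)
  have "cmod (f l) \<le> K" for l
    using Lim_bounded[OF tendsto_norm[OF lim(3)]] lim(2) by blast
  then show ?case by blast
qed (rule base_bounded)

lemma (in operator_calculus) calc_bounded_ops:
  assumes "calc f T S" shows "T \<in> bounded_ops" "S \<in> bounded_ops"
  using assms by (induction rule: calc.induct)
    (auto intro: base_bounded_ops base_cnj bounded_ops_plus bounded_ops_scale)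

lemma (in operator_calculus) calc_adjoint: "calc f T S \<Longrightarrow> cinner (T x) y = cinner x (S y)"
proof (induction rule: calc.induct)
  case (lim F P Q K f T S)
  have "(\<lambda>n. cinner (P n x) y) \<longlonglongrightarrow> cinner (T x) y"
    by (intro cinner.tendsto tendsto_const lim)
  moreover have "(\<lambda>n. cinner (P n x) y) \<longlonglongrightarrow> cinner x (S y)"
    unfolding lim.IH by (intro cinner.tendsto tendsto_const lim)
  ultimately show ?case by (rule LIMSEQ_unique)
qed (auto simp: base_adjoint cinner_add_left cinner_add_right cinner_scaleC_left cinner_scaleC_right)

lemma (in operator_calculus) calc_integrable: "calc f T S \<Longrightarrow> integrable (\<mu> x) f"
  using calc_measurable calc_bounded integrable_bounded by blast

lemma (in operator_calculus) calc_form: "calc f T S \<Longrightarrow> cinner x (T x) = (LINT l|\<mu> x. f l)"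
proof (induction rule: calc.induct)
  case (add f T S g T' S')
  then show ?case using calc_integrable by (simp add: cinner_add_right)
next
  case (scale f T S c)
  then show ?case using calc_integrable by (simp add: cinner_scaleC_right)
next
  case (lim F P Q K f T S)
  have "(\<lambda>n. cinner x (P n x)) \<longlonglongrightarrow> cinner x (T x)"
    by (intro cinner.tendsto tendsto_const lim)
  moreover have "(\<lambda>n. cinner x (P n x)) \<longlonglongrightarrow> (LINT l|\<mu> x. f l)"
    unfolding lim.IH
  proof (rule integral_dominated_convergence[where w = "\<lambda>_. K"])
    show "f \<in> borel_measurable (\<mu> x)"
      by (intro measurable_\<mu> calc_measurable[OF calc.lim[OF lim.hyps]])
    show "F n \<in> borel_measurable (\<mu> x)" for n
      by (intro measurable_\<mu> calc_measurable[OF lim.hyps(1)])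
    show "integrable (\<mu> x) (\<lambda>_. K)"
      by (rule finite_measure.integrable_const[OF finite_\<mu>])
  qed (intro AE_I2 lim.hyps)+
  ultimately show ?case by (rule LIMSEQ_unique)
qed (rule base_form)

lemma (in operator_calculus) calc_cnj: "calc f T S \<Longrightarrow> calc (\<lambda>l. cnj (f l)) S T"
proof (induction rule: calc.induct)
  case (scale f T S c)
  then show ?case using calc.scale[OF scale(2), of "cnj c"] by simp
next
  case (lim F P Q K f T S)
  show ?case
    by (rule calc.lim[of "\<lambda>n l. cnj (F n l)" Q P K]) (use lim in \<open>auto intro!: tendsto_cnj\<close>)
qed (auto intro: calc.base calc.add base_cnj)

text \<open>The two components converge for different reasons: \<open>T\<close> is continuous and is
  applied to the convergent \<open>P n x\<close>, whereas the \<open>Q n\<close> are evaluated at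
  the fixed vector \<open>S x\<close>.\<close>

lemma (in operator_calculus) calc_mult_lim:
  assumes mult: "\<And>n. calc (\<lambda>l. f l * F n l) (T \<circ> P n) (Q n \<circ> S)" and f: "calc f T S"
    and bound: "\<And>n l. cmod (F n l) \<le> K"
    and lim: "\<And>l. (\<lambda>n. F n l) \<longlonglongrightarrow> g l" "\<And>x. (\<lambda>n. P n x) \<longlonglongrightarrow> T' x" "\<And>x. (\<lambda>n. Q n x) \<longlonglongrightarrow> S' x"
    and ops: "T' \<in> bounded_ops" "S' \<in> bounded_ops"
  shows "calc (\<lambda>l. f l * g l) (T \<circ> T') (S' \<circ> S)"
proof -
  obtain L where L: "\<And>l. cmod (f l) \<le> L" using calc_bounded[OF f] by blast
  have "0 \<le> L" using L[of 0] norm_ge_zero order_trans by blast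
  then have "cmod (f l * F n l) \<le> L * K" for n l
    by (simp add: norm_mult mult_mono L bound)
  moreover have "(\<lambda>n. f l * F n l) \<longlonglongrightarrow> f l * g l" for l by (intro tendsto_intros lim)
  moreover have "(\<lambda>n. (T \<circ> P n) x) \<longlonglongrightarrow> (T \<circ> T') x" for x
    using bounded_linear.tendsto[OF bounded_ops_bounded_linear[OF calc_bounded_ops(1)[OF f]] lim(2)] by simp
  moreover have "(\<lambda>n. (Q n \<circ> S) x) \<longlonglongrightarrow> (S' \<circ> S) x" for x using lim(3) by simp
  moreover have "T \<circ> T' \<in> bounded_ops" "S' \<circ> S \<in> bounded_ops"
    using ops calc_bounded_ops[OF f] by (auto intro: bounded_ops_comp)
  ultimately show ?thesis by (rule calc.lim[OF mult])
qed

lemma (in operator_calculus) calc_base_mult: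
  assumes b: "base f T S"
  shows "calc g T' S' \<Longrightarrow> calc (\<lambda>l. f l * g l) (T \<circ> T') (S' \<circ> S)"
proof (induction rule: calc.induct)
  case (base g T' S')
  then show ?case using base_mult[OF b] calc.base by blast
next
  case (add g T' S' h T'' S'')
  have "calc (\<lambda>l. f l * g l + f l * h l) (\<lambda>x. (T \<circ> T') x + (T \<circ> T'') x) (\<lambda>x. (S' \<circ> S) x + (S'' \<circ> S) x)"
    by (rule calc.add[OF add(3,4)])
  then show ?case by (simp add: comp_def distrib_left bounded_ops_add[OF base_bounded_ops[OF b]])
next
  case (scale g T' S' c)
  have "calc (\<lambda>l. c * (f l * g l)) (\<lambda>x. c *\<^sub>C (T \<circ> T') x) (\<lambda>x. cnj c *\<^sub>C (S' \<circ> S) x)"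
    by (rule calc.scale[OF scale(2)])
  then show ?case
    by (simp add: comp_def mult.left_commute[of c] bounded_ops_scaleC[OF base_bounded_ops[OF b]])
next
  case (lim F P Q K g T' S')
  show ?case by (rule calc_mult_lim[OF lim.IH calc.base[OF b] lim.hyps(2-7)])
qed

lemma (in operator_calculus) calc_mult:
  assumes g: "calc g T' S'"
  shows "calc f T S \<Longrightarrow> calc (\<lambda>l. f l * g l) (T \<circ> T') (S' \<circ> S)"
proof (induction rule: calc.induct)
  case (base f T S)
  then show ?case using g by (rule calc_base_mult)
next
  case (add f T S h T'' S'')
  have "calc (\<lambda>l. f l * g l + h l * g l) (\<lambda>x. (T \<circ> T') x + (T'' \<circ> T') x) (\<lambda>x. (S' \<circ> S) x + (S' \<circ> S'') x)"
    by (rule calc.add[OF add(3,4)])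
  then show ?case by (simp add: comp_def distrib_right bounded_ops_add[OF calc_bounded_ops(2)[OF g]])
next
  case (scale f T S c)
  have "calc (\<lambda>l. c * (f l * g l)) (\<lambda>x. c *\<^sub>C (T \<circ> T') x) (\<lambda>x. cnj c *\<^sub>C (S' \<circ> S) x)"
    by (rule calc.scale[OF scale(2)])
  then show ?case
    by (simp add: comp_def mult.assoc bounded_ops_scaleC[OF calc_bounded_ops(2)[OF g]])
next
  case (lim F P Q K f T S)
  \<comment> \<open>Taking adjoints swaps the factors and reduces to a limit in the second factor.\<close>
  have "calc (\<lambda>l. cnj (g l) * cnj (F n l)) (S' \<circ> Q n) (P n \<circ> T')" for n
    using calc_cnj[OF lim.IH[of n]] by (simp add: comp_def mult.commute[of "F _ _"])
  then have "calc (\<lambda>l. cnj (g l) * cnj (f l)) (S' \<circ> S) (T \<circ> T')"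
    by (rule calc_mult_lim[where K = K]) (use lim in \<open>auto intro!: tendsto_cnj calc_cnj[OF g]\<close>)
  from calc_cnj[OF this] show ?case by (simp add: comp_def mult.commute[of "f _"])
qed

lemma (in operator_calculus) calc_unique: "calc f T S \<Longrightarrow> calc f T' S' \<Longrightarrow> T = T'"
  by (rule bounded_ops_eqI) (auto simp: calc_bounded_ops calc_form)

text \<open>The squared norm is the form of \<open>S \<circ> T\<close>, which represents |f|^2.
  Hence sending \<open>f\<close> to \<open>T x\<close> is isometric from L^2 of
  \<open>\<mu> x\<close>; every convergence argument below rests on this.\<close>

lemma (in operator_calculus) calc_norm:
  assumes "calc f T S" shows "(norm (T x))\<^sup>2 = (LINT l|\<mu> x. (cmod (f l))\<^sup>2)"
proof -
  have "complex_of_real ((norm (T x))\<^sup>2) = cinner x (S (T x))"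
    by (simp only: cinner_norm[symmetric] calc_adjoint[OF assms])
  also have "\<dots> = (LINT l|\<mu> x. cnj (f l) * f l)"
    using calc_form[OF calc_mult[OF assms calc_cnj[OF assms]], of x] by simp
  also have "\<dots> = (LINT l|\<mu> x. complex_of_real ((cmod (f l))\<^sup>2))"
    by (simp only: complex_norm_square mult.commute)
  finally show ?thesis using of_real_eq_iff by (simp only: integral_complex_of_real) blast
qed

lemma (in operator_calculus) measure_\<mu>_UNIV: "measure (\<mu> x) UNIV = (norm x)\<^sup>2"
  using calc_norm[OF calc.base[OF base_one], of x] by simp

lemma (in operator_calculus) calc_norm_le:
  assumes f: "calc f T S" and K: "\<And>l. cmod (f l) \<le> K" shows "norm (T x) \<le> K * norm x"
proof -
  have "0 \<le> K" using K[of 0] norm_ge_zero order_trans by blast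
  have le: "(cmod (f l))\<^sup>2 \<le> K\<^sup>2" for l by (intro power_mono K) simp
  note [measurable] = calc_measurable[OF f]
  have "(LINT l|\<mu> x. (cmod (f l))\<^sup>2) \<le> (LINT l|\<mu> x. K\<^sup>2)"
  proof (rule integral_mono)
    show "integrable (\<mu> x) (\<lambda>l. (cmod (f l))\<^sup>2)"
      by (rule integrable_bounded[where K = "K\<^sup>2"]) (measurable, simp only: real_norm_def abs_power2 le)
    show "integrable (\<mu> x) (\<lambda>l. K\<^sup>2)"
      by (rule finite_measure.integrable_const[OF finite_\<mu>])
  qed (rule le)
  also have "\<dots> = (K * norm x)\<^sup>2"
    by (simp add: measure_\<mu>_UNIV power_mult_distrib)
  finally have "(norm (T x))\<^sup>2 \<le> (K * norm x)\<^sup>2"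
    unfolding calc_norm[OF f] .
  then show ?thesis by (rule power2_le_imp_le) (simp add: \<open>0 \<le> K\<close>)
qed

section \<open>Strong convergence from dominated pointwise convergence\<close>

lemma (in operator_calculus) calc_diff_norm:
  assumes "calc f T S" "calc g T' S'"
  shows "(norm (T x - T' x))\<^sup>2 = (LINT l|\<mu> x. (cmod (f l - g l))\<^sup>2)"
  using calc_norm[OF calc.add[OF assms(1) calc.scale[OF assms(2), of "- 1"]], of x]
  by (simp add: scaleC_minus_one)

text \<open>By the isometry it is enough that the functions are Cauchy in L^2 of
  \<open>\<mu> x\<close>, which dominated convergence provides. The majorant \<open>w\<close> may be
  unbounded and is tied to the single vector \<open>x\<close>; this generality is what later reaches
  the domain of an unbounded operator.\<close>

lemma (in operator_calculus) calc_convergent: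
  assumes F: "\<And>n. calc (F n) (P n) (Q n)" and bound: "\<And>n l. cmod (F n l) \<le> w l"
    and w: "integrable (\<mu> x) (\<lambda>l. (w l)\<^sup>2)"
    and lim: "\<And>l. (\<lambda>n. F n l) \<longlonglongrightarrow> f l"
  shows "convergent (\<lambda>n. P n x)"
proof -
  define d where "d n = (LINT l|\<mu> x. (cmod (F n l - f l))\<^sup>2)" for n
  have "F n \<in> borel_measurable (\<mu> x)" for n
    by (intro measurable_\<mu> calc_measurable[OF F])
  moreover have "f \<in> borel_measurable (\<mu> x)"
    by (rule measurable_\<mu>[OF borel_measurable_LIMSEQ_metric[OF calc_measurable[OF F] lim]])
  ultimately have meas: "(\<lambda>l. (cmod (F n l - f l))\<^sup>2) \<in> borel_measurable (\<mu> x)" for n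
    by measurable
  have fw: "cmod (f l) \<le> w l" for l
    using Lim_bounded[OF tendsto_norm[OF lim]] bound by blast
  have le: "cmod (F n l - f l) \<le> 2 * w l" for n l
    using norm_triangle_ineq4[of "F n l" "f l"] bound[of n l] fw[of l] by linarith
  have le2: "norm ((cmod (F n l - f l))\<^sup>2) \<le> 4 * (w l)\<^sup>2" for n l
    using power_mono[OF le[of n l], of 2] by (simp add: power_mult_distrib)
  have w4: "integrable (\<mu> x) (\<lambda>l. 4 * (w l)\<^sup>2)" using w by simp
  have int: "integrable (\<mu> x) (\<lambda>l. (cmod (F n l - f l))\<^sup>2)" for n
  proof (rule Bochner_Integration.integrable_bound[OF w4 meas], rule AE_I2)
    show "norm ((cmod (F n l - f l))\<^sup>2) \<le> norm (4 * (w l)\<^sup>2)" for l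
      using le2[of n l] by simp
  qed
  have "d \<longlonglongrightarrow> (LINT l|\<mu> x. 0)" unfolding d_def
  proof (rule integral_dominated_convergence[OF _ meas w4])
    show "AE l in \<mu> x. (\<lambda>n. (cmod (F n l - f l))\<^sup>2) \<longlonglongrightarrow> 0"
    proof (rule AE_I2)
      fix l
      have "(\<lambda>n. (cmod (F n l - f l))\<^sup>2) \<longlonglongrightarrow> (cmod (f l - f l))\<^sup>2" by (intro tendsto_intros lim)
      then show "(\<lambda>n. (cmod (F n l - f l))\<^sup>2) \<longlonglongrightarrow> 0" by simp
    qed
    show "AE l in \<mu> x. norm ((cmod (F n l - f l))\<^sup>2) \<le> 4 * (w l)\<^sup>2" for n
      by (intro AE_I2 le2)
  qed simp
  then have d0: "d \<longlonglongrightarrow> 0" by simp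
  have est: "(norm (P m x - P n x))\<^sup>2 \<le> 2 * d m + 2 * d n" for m n
  proof -
    have pt: "(cmod (F m l - F n l))\<^sup>2 \<le> 2 * (cmod (F m l - f l))\<^sup>2 + 2 * (cmod (F n l - f l))\<^sup>2" for l
    proof -
      have "(cmod (F m l - F n l))\<^sup>2 \<le> (cmod (F m l - f l) + cmod (F n l - f l))\<^sup>2"
        using norm_triangle_ineq4[of "F m l - f l" "F n l - f l"] by (intro power_mono) auto
      also have "\<dots> \<le> 2 * (cmod (F m l - f l))\<^sup>2 + 2 * (cmod (F n l - f l))\<^sup>2"
        using sum_squares_bound[of "cmod (F m l - f l)" "cmod (F n l - f l)"]
        by (simp add: power2_sum)
      finally show ?thesis .
    qed
    have "(norm (P m x - P n x))\<^sup>2 = (LINT l|\<mu> x. (cmod (F m l - F n l))\<^sup>2)"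
      by (rule calc_diff_norm[OF F F])
    also have "\<dots> \<le> (LINT l|\<mu> x. 2 * (cmod (F m l - f l))\<^sup>2 + 2 * (cmod (F n l - f l))\<^sup>2)"
      using int by (intro integral_mono_AE' AE_I2 pt) auto
    also have "\<dots> = 2 * d m + 2 * d n" using int by (simp add: d_def)
    finally show ?thesis .
  qed
  have "Cauchy (\<lambda>n. P n x)"
  proof (rule metric_CauchyI)
    fix e :: real assume "e > 0"
    then obtain N where N: "\<And>n. n \<ge> N \<Longrightarrow> \<bar>d n\<bar> < e\<^sup>2 / 4"
      using LIMSEQ_D[OF d0, of "e\<^sup>2 / 4"] by auto
    have "dist (P m x) (P n x) < e" if "m \<ge> N" "n \<ge> N" for m n
    proof -
      have "(norm (P m x - P n x))\<^sup>2 < e\<^sup>2"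
        using est[of m n] N[OF that(1)] N[OF that(2)] by linarith
      then show ?thesis using \<open>e > 0\<close> by (simp add: dist_norm power2_less_imp_less)
    qed
    then show "\<exists>M. \<forall>m\<ge>M. \<forall>n\<ge>M. dist (P m x) (P n x) < e" by blast
  qed
  then show ?thesis by (rule Cauchy_convergent)
qed

lemma (in operator_calculus) calc_lim_ops:
  assumes F: "\<And>n. calc (F n) (P n) (Q n)" and bound: "\<And>n l. cmod (F n l) \<le> K"
    and lim: "\<And>l. (\<lambda>n. F n l) \<longlonglongrightarrow> f l"
  obtains T where "\<And>x. (\<lambda>n. P n x) \<longlonglongrightarrow> T x" "T \<in> bounded_ops"
proof
  show P: "(\<lambda>n. P n x) \<longlonglongrightarrow> lim (\<lambda>n. P n x)" for x
    using calc_convergent[OF F bound finite_measure.integrable_const[OF finite_\<mu>] lim]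
      convergent_LIMSEQ_iff by blast
  note ops = calc_bounded_ops(1)[OF F]
  show "(\<lambda>x. lim (\<lambda>n. P n x)) \<in> bounded_ops"
  proof (rule bounded_opsI)
    show "lim (\<lambda>n. P n (x + y)) = lim (\<lambda>n. P n x) + lim (\<lambda>n. P n y)" for x y
      using tendsto_add[OF P P] by (intro limI) (simp add: bounded_ops_add[OF ops])
    show "lim (\<lambda>n. P n (c *\<^sub>C x)) = c *\<^sub>C lim (\<lambda>n. P n x)" for c x
      using scaleC.tendsto[OF tendsto_const P] by (intro limI) (simp add: bounded_ops_scaleC[OF ops])
    show "norm (lim (\<lambda>n. P n x)) \<le> K * norm x" for x
      using Lim_bounded[OF tendsto_norm[OF P]] calc_norm_le[OF F bound] by blast
  qed
qed

text \<open>Strong convergence of both components, demanded by the limit rule, is automatic: the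
  argument for \<open>F\<close> is repeated for the conjugate functions, whose operators are the
  adjoints.\<close>

lemma (in operator_calculus) calc_limE:
  assumes F: "\<And>n. calc (F n) (P n) (Q n)" and bound: "\<And>n l. cmod (F n l) \<le> K"
    and lim: "\<And>l. (\<lambda>n. F n l) \<longlonglongrightarrow> f l"
  obtains T S where "calc f T S" "\<And>x. (\<lambda>n. P n x) \<longlonglongrightarrow> T x"
proof -
  obtain T where T: "\<And>x. (\<lambda>n. P n x) \<longlonglongrightarrow> T x" "T \<in> bounded_ops"
    using calc_lim_ops[OF assms] by blast
  obtain S where S: "\<And>x. (\<lambda>n. Q n x) \<longlonglongrightarrow> S x" "S \<in> bounded_ops"
    using calc_lim_ops[of "\<lambda>n l. cnj (F n l)" Q P K "\<lambda>l. cnj (f l)"] calc_cnj[OF F] bound tendsto_cnj[OF lim]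
    by auto
  show ?thesis using that calc.lim[OF F bound lim T(1) S(1) T(2) S(2)] T(1) by blast
qed

text \<open>Commutation with \<open>A\<close> passes to strong limits because \<open>A\<close> is
  continuous. Both inclusions between the commutants use this algebra, and for A = \<open>id\<close>
  it becomes the algebra of all functions that have an operator.\<close>

lemma (in operator_calculus) bounded_limit_algebra_commuting:
  assumes A: "A \<in> bounded_ops"
  shows "bounded_limit_algebra {f. \<exists>T S. calc f T S \<and> A \<circ> T = T \<circ> A}"
proof
  show "(\<lambda>_. c) \<in> {f. \<exists>T S. calc f T S \<and> A \<circ> T = T \<circ> A}" for c
    using calc.scale[OF calc.base[OF base_one], of c] bounded_ops_scaleC[OF A]
    by (fastforce simp: fun_eq_iff)
next
  fix f g assume "f \<in> {f. \<exists>T S. calc f T S \<and> A \<circ> T = T \<circ> A}" "g \<in> {f. \<exists>T S. calc f T S \<and> A \<circ> T = T \<circ> A}"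
  then obtain T S T' S' where *: "calc f T S" "A \<circ> T = T \<circ> A" "calc g T' S'" "A \<circ> T' = T' \<circ> A" by blast
  have "calc (\<lambda>l. f l + g l) (\<lambda>x. T x + T' x) (\<lambda>x. S x + S' x)"
    "A \<circ> (\<lambda>x. T x + T' x) = (\<lambda>x. T x + T' x) \<circ> A"
    using * calc.add bounded_ops_add[OF A] by (auto simp: fun_eq_iff)
  then show "(\<lambda>l. f l + g l) \<in> {f. \<exists>T S. calc f T S \<and> A \<circ> T = T \<circ> A}" by blast
  have "calc (\<lambda>l. f l * g l) (T \<circ> T') (S' \<circ> S)" "A \<circ> (T \<circ> T') = (T \<circ> T') \<circ> A"
    using * calc_mult by (auto simp: fun_eq_iff)
  then show "(\<lambda>l. f l * g l) \<in> {f. \<exists>T S. calc f T S \<and> A \<circ> T = T \<circ> A}" by blast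
next
  fix F :: "nat \<Rightarrow> real \<Rightarrow> complex" and K f
  assume F: "F n \<in> {f. \<exists>T S. calc f T S \<and> A \<circ> T = T \<circ> A}" and bound: "cmod (F n l) \<le> K"
    and lim: "(\<lambda>n. F n l) \<longlonglongrightarrow> f l" for n l
  then obtain P Q where PQ: "\<And>n. calc (F n) (P n) (Q n)" and comm: "\<And>n. A \<circ> P n = P n \<circ> A"
    by simp metis
  obtain T S where T: "calc f T S" "\<And>x. (\<lambda>n. P n x) \<longlonglongrightarrow> T x"
    using calc_limE[OF PQ bound lim] by blast
  have "A (T x) = T (A x)" for x
  proof (rule LIMSEQ_unique)
    show "(\<lambda>n. A (P n x)) \<longlonglongrightarrow> A (T x)"
      by (rule bounded_linear.tendsto[OF bounded_ops_bounded_linear[OF A] T(2)])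
    show "(\<lambda>n. A (P n x)) \<longlonglongrightarrow> T (A x)"
      using T(2)[of "A x"] comm by (simp add: fun_eq_iff)
  qed
  then show "f \<in> {f. \<exists>T S. calc f T S \<and> A \<circ> T = T \<circ> A}" using T(1) by (auto simp: fun_eq_iff)
qed

lemma (in operator_calculus) bounded_limit_algebra_calc:
  "bounded_limit_algebra {f. \<exists>T S. calc f T S}"
  using bounded_limit_algebra_commuting[OF id_bounded_ops] by simp

section \<open>Functional calculus of a projection-valued measure\<close>

locale projection_measure =
  fixes E :: "real set \<Rightarrow> 'a::complex_hilbert_space \<Rightarrow> 'a"
  assumes pvm: "projection_valued_measure E"

lemma orthogonal_projection_form:
  assumes "orthogonal_projection P"
  shows "cinner x (P x) = complex_of_real ((norm (P x))\<^sup>2)"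
proof -
  have "cinner x (P x) = cinner x (P (P x))"
    using assms by (simp add: orthogonal_projection_def fun_eq_iff)
  also have "\<dots> = cinner (P x) (P x)" using assms by (simp add: orthogonal_projection_def)
  finally show ?thesis by (simp only: cinner_norm)
qed

lemma (in projection_measure) orthogonal_projection: "B \<in> sets borel \<Longrightarrow> orthogonal_projection (E B)"
  using pvm by (simp add: projection_valued_measure_def)

lemma (in projection_measure) E_bounded_ops: "B \<in> sets borel \<Longrightarrow> E B \<in> bounded_ops"
  using orthogonal_projection by (simp add: orthogonal_projection_def)

lemma (in projection_measure) E_adjoint: "B \<in> sets borel \<Longrightarrow> cinner (E B x) y = cinner x (E B y)"
  using orthogonal_projection by (simp add: orthogonal_projection_def)

lemma (in projection_measure) sets_scalar_measure [simp]: "sets (scalar_measure E x) = sets borel"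
  unfolding scalar_measure_def using sets.sigma_sets_eq[of borel]
  by (subst sets_measure_of) (auto simp: sets.space_closed)

lemma (in projection_measure) space_scalar_measure [simp]: "space (scalar_measure E x) = UNIV"
  using sets_eq_imp_space_eq[OF sets_scalar_measure] by simp

lemma (in projection_measure) emeasure_scalar_measure:
  assumes B: "B \<in> sets borel"
  shows "emeasure (scalar_measure E x) B = ennreal ((norm (E B x))\<^sup>2)"
proof -
  have form: "Re (cinner x (E A x)) = (norm (E A x))\<^sup>2" if "A \<in> sets borel" for A
    using orthogonal_projection_form[OF orthogonal_projection[OF that], of x] by simp
  have "emeasure (scalar_measure E x) B = ennreal (Re (cinner x (E B x)))"
  proof (rule emeasure_measure_of[OF scalar_measure_def])
    show "positive (sets (scalar_measure E x)) (\<lambda>B. ennreal (Re (cinner x (E B x))))"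
      using pvm by (simp add: positive_def projection_valued_measure_def cinner.zero_right)
    show "countably_additive (sets (scalar_measure E x)) (\<lambda>B. ennreal (Re (cinner x (E B x))))"
    proof (rule countably_additiveI)
      fix A :: "nat \<Rightarrow> real set"
      assume "range A \<subseteq> sets (scalar_measure E x)" and disj: "disjoint_family A"
      then have A: "range A \<subseteq> sets borel" by simp
      have "(\<lambda>n. E (A n) x) sums E (\<Union>n. A n) x"
        using pvm A disj by (simp add: projection_valued_measure_def)
      then have "(\<lambda>n. Re (cinner x (E (A n) x))) sums Re (cinner x (E (\<Union>n. A n) x))"
        by (intro sums_Re bounded_linear.sums[OF cinner.bounded_linear_right])
      then show "(\<Sum>n. ennreal (Re (cinner x (E (A n) x)))) = ennreal (Re (cinner x (E (\<Union>n. A n) x)))"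
        using A by (intro suminf_ennreal_eq) (auto simp: form)
    qed
  qed (use B in \<open>auto simp: sets.space_closed\<close>)
  then show ?thesis by (simp add: form[OF B])
qed

lemma (in projection_measure) finite_measure_scalar_measure: "finite_measure (scalar_measure E x)"
  by (rule finite_measureI) (simp add: emeasure_scalar_measure)

definition indicator_triple ::
  "(real set \<Rightarrow> 'a::complex_hilbert_space \<Rightarrow> 'a) \<Rightarrow> (real \<Rightarrow> complex) \<Rightarrow> ('a \<Rightarrow> 'a) \<Rightarrow> ('a \<Rightarrow> 'a) \<Rightarrow> bool" where
  "indicator_triple E f T S \<longleftrightarrow> (\<exists>B\<in>sets borel. f = indicator B \<and> T = E B \<and> S = E B)"

lemma LINT_complex_indicator:
  "(LINT l|M. indicator B l :: complex) = complex_of_real (measure M (B \<inter> space M))"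
proof -
  have "(LINT l|M. indicator B l :: complex) = (LINT l|M. complex_of_real (indicator B l))"
    by (intro Bochner_Integration.integral_cong) (auto simp: indicator_def)
  then show ?thesis by (simp only: integral_complex_of_real Bochner_Integration.integral_indicator)
qed

lemma (in projection_measure) operator_calculus_indicators:
  "operator_calculus (scalar_measure E) (indicator_triple E)"
proof (rule operator_calculus.intro)
  fix x y :: 'a and f g :: "real \<Rightarrow> complex" and T S T' S' :: "'a \<Rightarrow> 'a"
  show "finite_measure (scalar_measure E x)" by (rule finite_measure_scalar_measure)
  show "sets (scalar_measure E x) = sets borel" by simp
  show "indicator_triple E (\<lambda>_. 1) id id"
    using pvm unfolding indicator_triple_def projection_valued_measure_def
    by (intro bexI[of _ UNIV]) auto
  assume "indicator_triple E f T S"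
  then obtain B where B: "B \<in> sets borel" "f = indicator B" "T = E B" "S = E B"
    by (auto simp: indicator_triple_def)
  show "f \<in> borel_measurable borel" using B by simp
  show "\<exists>K. \<forall>l. cmod (f l) \<le> K" using B by (intro exI[of _ 1]) (auto simp: indicator_def)
  show "T \<in> bounded_ops" using B E_bounded_ops by simp
  show "cinner (T x) y = cinner x (S y)" using B E_adjoint by simp
  show "cinner x (T x) = (LINT l|scalar_measure E x. f l)"
    using B orthogonal_projection_form[OF orthogonal_projection[OF B(1)], of x]
    by (simp add: LINT_complex_indicator measure_def emeasure_scalar_measure)
  have "(\<lambda>l. cnj (f l)) = f" using B by (auto simp: indicator_def)
  then show "indicator_triple E (\<lambda>l. cnj (f l)) S T" using B by (auto simp: indicator_triple_def)
  assume "indicator_triple E g T' S'"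
  then obtain C where C: "C \<in> sets borel" "g = indicator C" "T' = E C" "S' = E C"
    by (auto simp: indicator_triple_def)
  have "E (B \<inter> C) = E B \<circ> E C" "E (C \<inter> B) = E C \<circ> E B"
    using pvm B(1) C(1) unfolding projection_valued_measure_def by blast+
  then show "indicator_triple E (\<lambda>l. f l * g l) (T \<circ> T') (S' \<circ> S)"
    unfolding indicator_triple_def using B C
    by (intro bexI[of _ "B \<inter> C"]) (auto simp: Int_commute indicator_inter_arith)
qed

sublocale projection_measure \<subseteq> operator_calculus "scalar_measure E" "indicator_triple E"
  by (rule operator_calculus_indicators)

lemma (in projection_measure) calc_indicator: "B \<in> sets borel \<Longrightarrow> calc (indicator B) (E B) (E B)"
  by (rule calc.base) (auto simp: indicator_triple_def)

lemma (in projection_measure) calc_exists: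
  assumes "f \<in> borel_measurable borel" "\<And>l. cmod (f l) \<le> K"
  obtains T S where "calc f T S"
proof -
  have "f \<in> {f. \<exists>T S. calc f T S}"
    using calc_indicator assms
    by (intro bounded_limit_algebra.bounded_measurable[OF bounded_limit_algebra_calc, of f K]) auto
  then show ?thesis using that by blast
qed

text \<open>For bounded \<open>f\<close> the domain condition holds at every vector, so two
  candidates are everywhere defined and have the same quadratic form. This justifies the definite
  description behind \<open>functional_calculus\<close>.\<close>

lemma (in projection_measure) spectral_integral_unique:
  assumes f: "calc f T S" and T': "is_spectral_integral E f T'"
  shows "T' = (\<lambda>x. Some (T x))"
proof -
  note [measurable] = calc_measurable[OF f]
  obtain K where K: "\<And>l. cmod (f l) \<le> K" using calc_bounded[OF f] by blast
  have "integrable (scalar_measure E x) (\<lambda>l. (cmod (f l))\<^sup>2)" for x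
    by (rule integrable_bounded[where K = "K\<^sup>2"])
      (measurable, simp only: real_norm_def abs_power2, intro power_mono K norm_ge_zero)
  then have dom: "dom T' = UNIV" using T' by (auto simp: is_spectral_integral_def)
  have "the (T' x) - T x = 0" for x
  proof (rule quadratic_form_zero[of "\<lambda>x. the (T' x) - T x"])
    show "the (T' (x + y)) - T (x + y) = (the (T' x) - T x) + (the (T' y) - T y)" for x y
      using T' dom by (simp add: is_spectral_integral_def linear_operator_def
          bounded_ops_add[OF calc_bounded_ops(1)[OF f]])
    show "the (T' (c *\<^sub>C x)) - T (c *\<^sub>C x) = c *\<^sub>C (the (T' x) - T x)" for c x
      using T' dom by (simp add: is_spectral_integral_def linear_operator_def
          bounded_ops_scaleC[OF calc_bounded_ops(1)[OF f]] scaleC.diff_right)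
    show "cinner x (the (T' x) - T x) = 0" for x
      using T' dom by (simp add: is_spectral_integral_def cinner.diff_right calc_form[OF f])
  qed
  then show ?thesis using dom by (intro ext) (metis UNIV_I domIff eq_iff_diff_eq_0 option.collapse)
qed

lemma (in projection_measure) spectral_integral_calc:
  assumes f: "calc f T S"
  shows "is_spectral_integral E f (\<lambda>x. Some (T x))"
proof -
  note [measurable] = calc_measurable[OF f]
  obtain K where K: "\<And>l. cmod (f l) \<le> K" using calc_bounded[OF f] by blast
  have "integrable (scalar_measure E x) (\<lambda>l. (cmod (f l))\<^sup>2)" for x
    by (rule integrable_bounded[where K = "K\<^sup>2"])
      (measurable, simp only: real_norm_def abs_power2, intro power_mono K norm_ge_zero)
  then show ?thesis
    using calc_bounded_ops(1)[OF f]
    by (auto simp: is_spectral_integral_def linear_operator_def bounded_ops_add bounded_ops_scaleC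
        calc_form[OF f])
qed

section \<open>Exponentials and the commutant they generate\<close>

definition expi :: "real \<Rightarrow> real \<Rightarrow> complex" where
  "expi t l = exp (\<i> * complex_of_real t * complex_of_real l)"

lemma expi_eq_cis: "expi t l = cis (t * l)"
  by (simp add: expi_def cis_conv_exp mult.assoc)

lemma (in projection_measure) calc_expi:
  obtains S where "calc (expi t) (\<lambda>x. the ((THE T. is_spectral_integral E (expi t) T) x)) S"
proof -
  have "expi t \<in> borel_measurable borel"
    unfolding expi_def by (intro borel_measurable_continuous_onI continuous_intros)
  then obtain T S where TS: "calc (expi t) T S"
    by (rule calc_exists[of "expi t" 1]) (auto simp: expi_eq_cis)
  have "(THE T. is_spectral_integral E (expi t) T) = (\<lambda>x. Some (T x))"
    by (rule the_equality) (auto intro: spectral_integral_calc[OF TS] dest: spectral_integral_unique[OF TS])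
  then show ?thesis using TS that by simp
qed

text \<open>The limit is the derivative of sin(y l) at y = 0, sampled at y = 1/(n + 1).\<close>

lemma scaled_sin_tendsto: "(\<lambda>n. real (Suc n) * sin (l / real (Suc n))) \<longlonglongrightarrow> l"
proof -
  have "((\<lambda>y. sin (y * l)) has_real_derivative l) (at 0)"
    by (auto intro!: derivative_eq_intros)
  then have "((\<lambda>h. sin (h * l) / h) \<longlongrightarrow> l) (at 0)"
    by (simp add: DERIV_def)
  moreover have "filterlim (\<lambda>n. inverse (real (Suc n))) (at 0) sequentially"
    by (rule filterlim_atI[OF LIMSEQ_inverse_real_of_nat]) simp
  ultimately have "(\<lambda>n. sin (inverse (real (Suc n)) * l) / inverse (real (Suc n))) \<longlonglongrightarrow> l"
    by (rule filterlim_compose)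
  then show ?thesis by (simp add: divide_inverse mult.commute)
qed

text \<open>The exponentials generate all indicators, since \<open>n sin (l / n)\<close> tends to \<open>l\<close>.\<close>

lemma (in projection_measure) commutant_exponentials:
  assumes U: "\<And>t. \<exists>S. calc (expi t) (U t) S"
  shows "commutant (range U) = commutant (E ` sets borel)"
proof
  show "commutant (range U) \<subseteq> commutant (E ` sets borel)"
  proof
    fix A assume "A \<in> commutant (range U)"
    then have A: "A \<in> bounded_ops" and comm: "\<And>t. A \<circ> U t = U t \<circ> A"
      by (auto simp: commutant_def)
    let ?D = "{f. \<exists>T S. calc f T S \<and> A \<circ> T = T \<circ> A}"
    interpret D: bounded_limit_algebra ?D by (rule bounded_limit_algebra_commuting[OF A])
    have e: "expi t \<in> ?D" for t using U comm by blast
    define s where "s n l = real (Suc n) * sin (l / real (Suc n))" for n l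
    \<comment> \<open>Euler's formula for the sine; the factor -\<i>/2 is 1/(2 \<i>).\<close>
    have s_eq: "complex_of_real (s n l) = (- \<i> * complex_of_real (real (Suc n)) / 2) *
        (expi (1 / real (Suc n)) l - expi (- 1 / real (Suc n)) l)" for n l
      unfolding expi_eq_cis s_def by (simp add: complex_eq_iff)
    have "(\<lambda>l. complex_of_real (s n l)) \<in> ?D" for n
      unfolding s_eq by (intro D.mult D.const D.diff e)
    moreover have "\<bar>s n l\<bar> \<le> real (Suc n)" for n l
      using mult_left_mono[OF abs_sin_le_one[of "l / real (Suc n)"], of "real (Suc n)"]
      by (simp add: s_def abs_mult)
    moreover have "(\<lambda>n. s n l) \<longlonglongrightarrow> l" for l
      unfolding s_def by (rule scaled_sin_tendsto)
    ultimately have ind: "(\<lambda>l. indicator B l) \<in> ?D" if "B \<in> sets borel" for B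
      using that by (rule D.indicator_mem)
    have "A \<circ> E B = E B \<circ> A" if B: "B \<in> sets borel" for B
    proof -
      \<comment> \<open>Membership in \<open>?D\<close> only provides some operator for the
        indicator that commutes with \<open>A\<close>; uniqueness in the calculus identifies it with
        \<open>E B\<close>.\<close>
      obtain T S where "calc (indicator B) T S" "A \<circ> T = T \<circ> A" using ind[OF B] by auto
      then show ?thesis using calc_unique[OF _ calc_indicator[OF B]] by blast
    qed
    then show "A \<in> commutant (E ` sets borel)" using A by (auto simp: commutant_def)
  qed
  show "commutant (E ` sets borel) \<subseteq> commutant (range U)"
  proof
    fix A assume "A \<in> commutant (E ` sets borel)"
    then have A: "A \<in> bounded_ops" and comm: "\<And>B. B \<in> sets borel \<Longrightarrow> A \<circ> E B = E B \<circ> A"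
      by (auto simp: commutant_def)
    interpret D: bounded_limit_algebra "{f. \<exists>T S. calc f T S \<and> A \<circ> T = T \<circ> A}"
      by (rule bounded_limit_algebra_commuting[OF A])
    have "A \<circ> U t = U t \<circ> A" for t
    proof -
      obtain S where S: "calc (expi t) (U t) S" using U by blast
      obtain K where K: "\<And>l. cmod (expi t l) \<le> K" using calc_bounded[OF S] by blast
      have "expi t \<in> {f. \<exists>T S. calc f T S \<and> A \<circ> T = T \<circ> A}"
      proof (rule D.bounded_measurable[OF _ calc_measurable[OF S] K])
        fix B :: "real set" assume "B \<in> sets borel"
        then show "(\<lambda>l. indicator B l) \<in> {f. \<exists>T S. calc f T S \<and> A \<circ> T = T \<circ> A}"
          using calc_indicator[of B] comm[of B] by auto
      qed
      then obtain T S' where T: "calc (expi t) T S'" "A \<circ> T = T \<circ> A" by blast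
      then show ?thesis using calc_unique[OF S T(1)] by simp
    qed
    then show "A \<in> commutant (range U)" using A by (auto simp: commutant_def)
  qed
qed

lemma exp_itV_double_commutant:
  assumes E: "is_spectral_measure V (spectral_measure V)" and U: "\<And>t. U t = exp_itV V t"
  shows "von_neumann_generated (spectral_projections V) = commutant (commutant (range U))"
proof -
  interpret projection_measure "spectral_measure V"
    using E by unfold_locales (simp add: is_spectral_measure_def)
  have U': "U t = (\<lambda>x. the ((THE T. is_spectral_integral (spectral_measure V) (expi t) T) x))" for t
    unfolding U by (simp add: exp_itV_def fun_eq_iff functional_calculus_def expi_def[abs_def])
  have "\<exists>S. calc (expi t) (U t) S" for t
    unfolding U' by (rule calc_expi) blast
  then have "commutant (range U) = commutant (spectral_projections V)"
    unfolding spectral_projections_def by (rule commutant_exponentials)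
  moreover have "von_neumann_generated (spectral_projections V) = commutant (commutant (spectral_projections V))"
  proof (rule von_neumann_generated_eq)
    show "spectral_projections V \<subseteq> bounded_ops"
      by (auto simp: spectral_projections_def E_bounded_ops)
    fix A assume "A \<in> spectral_projections V"
    then obtain B where B: "B \<in> sets borel" "A = spectral_measure V B"
      by (auto simp: spectral_projections_def)
    then have "bounded_adjoint A = A" by (intro bounded_adjoint_eqI) (simp add: E_adjoint)
    then show "bounded_adjoint A \<in> spectral_projections V" using \<open>A \<in> spectral_projections V\<close> by simp
  qed
  ultimately show ?thesis by simp
qed

section \<open>Trigonometric moments of a unitary operator\<close>

text \<open>Carrying the inverse \<open>U'\<close> along, which is also the adjoint, provides
  negative powers and the adjoint component of each triple with natural exponents only.\<close>

locale unitary_pair =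
  fixes U U' :: "'a::complex_hilbert_space \<Rightarrow> 'a"
  assumes U_ops: "U \<in> bounded_ops" and U'_ops: "U' \<in> bounded_ops"
    and U_U' [simp]: "U (U' x) = x" and U'_U [simp]: "U' (U x) = x"
    and U_adjoint: "cinner (U x) y = cinner x (U' y)"

lemma (in unitary_pair) cinner_pow_left: "cinner ((U ^^ n) x) y = cinner x ((U' ^^ n) y)"
proof (induction n arbitrary: x)
  case (Suc n)
  have "cinner ((U ^^ Suc n) x) y = cinner ((U ^^ n) (U x)) y" by (simp add: funpow_swap1)
  also have "\<dots> = cinner x ((U' ^^ Suc n) y)" unfolding Suc by (simp add: U_adjoint)
  finally show ?case .
qed simp

lemma (in unitary_pair) U'_pow_U_pow [simp]: "(U' ^^ n) ((U ^^ n) x) = x"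
  by (induction n arbitrary: x) (simp_all add: funpow_swap1)

lemma (in unitary_pair) cinner_pow [simp]: "cinner ((U ^^ n) x) ((U ^^ n) y) = cinner x y"
  by (simp add: cinner_pow_left)

lemma (in unitary_pair) norm_pow [simp]: "norm ((U ^^ n) x) = norm x"
proof -
  have "complex_of_real ((norm ((U ^^ n) x))\<^sup>2) = complex_of_real ((norm x)\<^sup>2)"
    by (simp only: cinner_norm[symmetric] cinner_pow)
  then have "(norm ((U ^^ n) x))\<^sup>2 = (norm x)\<^sup>2" using of_real_eq_iff by blast
  then show ?thesis by (simp add: power2_eq_iff_nonneg)
qed

text \<open>The Toeplitz property: the inner product of two points of the orbit depends only on the
  difference of the exponents. The additive hypothesis states l - k = a - b without subtraction on
  naturals.\<close>

lemma (in unitary_pair) cinner_pow_eq: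
  assumes "a + k = b + l"
  shows "cinner ((U ^^ k) x) ((U ^^ l) x) = cinner ((U ^^ b) x) ((U ^^ a) x)"
proof (cases "b \<le> k")
  case True
  then have "k = (k - b) + b" "l = (k - b) + a" using assms by linarith+
  then obtain s where "k = s + b" "l = s + a" by blast
  then show ?thesis by (simp add: funpow_add)
next
  case False
  then have "b = (b - k) + k" "a = (b - k) + l" using assms by linarith+
  then obtain s where "b = s + k" "a = s + l" by blast
  then show ?thesis by (simp add: funpow_add)
qed

section \<open>Fejer measures on a finite grid of angles\<close>

lemma cis_int_multiple: "cis (2 * pi * of_int n) = 1"
  by (rule cis_multiple_2pi) simp

text \<open>Orthogonality of the characters of the cyclic group of order 2 N: for nonzero
  \<open>n\<close> this is a geometric sum over a (2 N)-th root of unity, and the bound on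
  \<open>n\<close> excludes the root 1.\<close>

lemma sum_cis_roots:
  fixes n :: int
  assumes N: "N > 0" and n: "\<bar>n\<bar> < 2 * int N"
  shows "(\<Sum>j<2*N. cis (of_int n * (pi * real j / real N))) = (if n = 0 then of_nat (2 * N) else 0)"
proof (cases "n = 0")
  case False
  define z where "z = cis (of_int n * pi / real N)"
  have "z \<noteq> 1"
  proof
    assume "z = 1"
    then have "exp (\<i> * complex_of_real (of_int n * pi / real N)) = 1" by (simp add: z_def cis_conv_exp)
    then obtain m :: int where "of_int n * pi / real N = of_int (2 * m) * pi" by (auto simp: exp_eq_1)
    then have "of_int n = of_int (2 * m) * real N" using N by (simp add: field_simps)
    then have "n = 2 * m * int N" by (metis of_int_eq_iff of_int_mult of_int_of_nat_eq)
    then have eq: "\<bar>n\<bar> = \<bar>m\<bar> * (2 * int N)" and "m \<noteq> 0" using False by (auto simp: abs_mult)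
    then have "1 * (2 * int N) \<le> \<bar>m\<bar> * (2 * int N)" by (intro mult_right_mono) auto
    then show False using n eq by linarith
  qed
  have "z ^ (2 * N) = cis (2 * pi * of_int n)"
    unfolding z_def Complex.DeMoivre using N by (intro arg_cong[where f = cis]) (simp add: field_simps)
  then have "z ^ (2 * N) = 1" by (simp only: cis_int_multiple)
  have "(\<Sum>j<2*N. cis (of_int n * (pi * real j / real N))) = (\<Sum>j<2*N. z ^ j)"
    by (intro sum.cong) (simp_all add: z_def Complex.DeMoivre mult_ac)
  also have "\<dots> = 0" using geometric_sum[OF \<open>z \<noteq> 1\<close>, of "2 * N"] \<open>z ^ (2 * N) = 1\<close> by simp
  finally show ?thesis using False by simp
qed simp

text \<open>With \<open>2 N\<close> grid points no aliasing occurs in the moments of order at most \<open>N\<close>.\<close>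

definition (in unitary_pair) fejer_weight :: "'a \<Rightarrow> nat \<Rightarrow> nat \<Rightarrow> real" where
  "fejer_weight x N j = (norm (\<Sum>k<N. cis (- (pi * real j / real N) * real k) *\<^sub>C (U ^^ k) x))\<^sup>2 / (2 * real N * real N)"

lemma (in unitary_pair) fejer_weight_nonneg: "0 \<le> fejer_weight x N j"
  by (simp add: fejer_weight_def)

text \<open>Expanding the square gives a double sum over exponents k and l, and summation over the
  grid keeps only the pairs with l - k = a - b. Their number is N - |a - b|, so the quotient is the
  Fejer factor 1 - |a - b| / N.\<close>

lemma (in unitary_pair) fejer_moment:
  assumes N: "N > 0" and ab: "a \<le> N" "b \<le> N"
  shows "(\<Sum>j<2*N. complex_of_real (fejer_weight x N j) * cis ((real a - real b) * (pi * real j / real N)))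
    = complex_of_real (real (card {k. k < N \<and> b \<le> a + k \<and> a + k < b + N}) / real N) * cinner ((U ^^ b) x) ((U ^^ a) x)"
proof -
  define t where "t j = pi * real j / real N" for j
  define c where "c = cinner ((U ^^ b) x) ((U ^^ a) x)"
  define m where "m k l = cinner ((U ^^ k) x) ((U ^^ l) x)" for k l
  define n where "n k l = int (a + k) - int (b + l)" for k l
  let ?v = "\<lambda>j. \<Sum>k<N. cis (- t j * real k) *\<^sub>C (U ^^ k) x"
  have sq: "complex_of_real ((norm (?v j))\<^sup>2) = (\<Sum>k<N. \<Sum>l<N. cis (t j * real k) * cis (- t j * real l) * m k l)" for j
    unfolding cinner_norm[symmetric] m_def cinner.sum_left
    by (simp add: cinner.sum_right cinner_scaleC_left cinner_scaleC_right cis_cnj mult_ac)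
  have "complex_of_real (2 * real N * real N) * (\<Sum>j<2*N. complex_of_real (fejer_weight x N j) * cis ((real a - real b) * t j))
      = (\<Sum>j<2*N. complex_of_real ((norm (?v j))\<^sup>2) * cis ((real a - real b) * t j))"
    unfolding sum_distrib_left fejer_weight_def t_def[symmetric] using N by (intro sum.cong) auto
  also have "\<dots> = (\<Sum>j<2*N. \<Sum>k<N. \<Sum>l<N. m k l * cis (of_int (n k l) * t j))"
    unfolding sq sum_distrib_right
    by (intro sum.cong refl) (simp add: n_def cis_mult algebra_simps)
  also have "\<dots> = (\<Sum>k<N. \<Sum>l<N. m k l * (\<Sum>j<2*N. cis (of_int (n k l) * t j)))"
    by (simp add: sum_distrib_left sum.swap[of _ "{..<N}" "{..<2*N}"])
  also have "\<dots> = (\<Sum>k<N. \<Sum>l<N. m k l * (if n k l = 0 then of_nat (2 * N) else 0))"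
  proof (intro sum.cong refl arg_cong2[where f = "(*)"])
    fix k l assume "k \<in> {..<N}" "l \<in> {..<N}"
    \<comment> \<open>The difference of \<open>a\<close> and \<open>b\<close> contributes at most N
      and that of \<open>k\<close> and \<open>l\<close> at most N - 1; hence 2 N grid points
      suffice.\<close>
    then have "\<bar>n k l\<bar> < 2 * int N" using ab by (auto simp: n_def)
    then show "(\<Sum>j<2*N. cis (of_int (n k l) * t j)) = (if n k l = 0 then of_nat (2 * N) else 0)"
      unfolding t_def by (rule sum_cis_roots[OF N])
  qed
  also have "\<dots> = (\<Sum>k<N. \<Sum>l<N. if l + b = a + k then of_nat (2 * N) * c else 0)"
    unfolding m_def c_def n_def by (intro sum.cong refl) (auto intro: cinner_pow_eq)
  also have "\<dots> = (\<Sum>k<N. if b \<le> a + k \<and> a + k < b + N then of_nat (2 * N) * c else 0)"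
  proof (intro sum.cong refl)
    fix k
    show "(\<Sum>l<N. if l + b = a + k then of_nat (2 * N) * c else 0)
      = (if b \<le> a + k \<and> a + k < b + N then of_nat (2 * N) * c else 0)"
    proof (cases "b \<le> a + k")
      case True
      then have "(\<Sum>l<N. if l + b = a + k then of_nat (2 * N) * c else 0)
          = (\<Sum>l<N. if l = a + k - b then of_nat (2 * N) * c else 0)"
        by (intro sum.cong) auto
      also have "\<dots> = (if a + k - b < N then of_nat (2 * N) * c else 0)" by simp
      finally show ?thesis using True by (simp add: less_diff_conv2 add.commute)
    next
      case False
      then show ?thesis by (intro trans[OF sum.neutral]) auto
    qed
  qed
  also have "\<dots> = (\<Sum>k\<in>{k. k < N \<and> b \<le> a + k \<and> a + k < b + N}. of_nat (2 * N) * c)"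
    by (intro sum.mono_neutral_cong_right) auto
  finally have "complex_of_real (2 * real N * real N) * (\<Sum>j<2*N. complex_of_real (fejer_weight x N j) * cis ((real a - real b) * t j))
    = of_nat (card {k. k < N \<and> b \<le> a + k \<and> a + k < b + N}) * (of_nat (2 * N) * c)" by simp
  then show ?thesis using N by (simp add: t_def c_def field_simps)
qed

text \<open>The crude estimate that at most a + b of the N indices are lost is enough for the limit
  and avoids distinguishing the sign of a - b.\<close>

lemma fejer_count_tendsto:
  "(\<lambda>n. real (card {k. k < Suc n \<and> b \<le> a + k \<and> a + k < b + Suc n}) / real (Suc n)) \<longlonglongrightarrow> 1"
proof (rule tendsto_sandwich)
  have fin: "finite {k. k < Suc n \<and> b \<le> a + k \<and> a + k < b + Suc n}" for n
    by (rule finite_subset[of _ "{..<Suc n}"]) auto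
  have low: "Suc n \<le> card {k. k < Suc n \<and> b \<le> a + k \<and> a + k < b + Suc n} + (a + b)" for n
  proof -
    have "{b..<Suc n - a} \<subseteq> {k. k < Suc n \<and> b \<le> a + k \<and> a + k < b + Suc n}" by auto
    from card_mono[OF fin this] show ?thesis by simp
  qed
  have up: "card {k. k < Suc n \<and> b \<le> a + k \<and> a + k < b + Suc n} \<le> Suc n" for n
    using card_mono[of "{..<Suc n}" "{k. k < Suc n \<and> b \<le> a + k \<and> a + k < b + Suc n}"] by auto
  have "1 - real (a + b) * inverse (real (Suc n))
      \<le> real (card {k. k < Suc n \<and> b \<le> a + k \<and> a + k < b + Suc n}) / real (Suc n)" for n
  proof -
    have "real (Suc n) \<le> real (card {k. k < Suc n \<and> b \<le> a + k \<and> a + k < b + Suc n}) + real (a + b)"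
      using low[of n] by (metis of_nat_add of_nat_le_iff)
    then have "(real (Suc n) - real (a + b)) / real (Suc n)
        \<le> real (card {k. k < Suc n \<and> b \<le> a + k \<and> a + k < b + Suc n}) / real (Suc n)"
      by (intro divide_right_mono) auto
    moreover have "(real (Suc n) - real (a + b)) / real (Suc n) = 1 - real (a + b) * inverse (real (Suc n))"
      by (simp add: field_simps)
    ultimately show ?thesis by (simp only:)
  qed
  then show "\<forall>\<^sub>F n in sequentially. 1 - real (a + b) * inverse (real (Suc n))
      \<le> real (card {k. k < Suc n \<and> b \<le> a + k \<and> a + k < b + Suc n}) / real (Suc n)"
    by (intro always_eventually allI)
  have "real (card {k. k < Suc n \<and> b \<le> a + k \<and> a + k < b + Suc n}) / real (Suc n) \<le> 1" for n
    using up[of n] by (simp del: of_nat_Suc)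
  then show "\<forall>\<^sub>F n in sequentially. real (card {k. k < Suc n \<and> b \<le> a + k \<and> a + k < b + Suc n}) / real (Suc n) \<le> 1"
    by (intro always_eventually allI)
  have "(\<lambda>n. 1 - real (a + b) * inverse (real (Suc n))) \<longlonglongrightarrow> 1 - real (a + b) * 0"
    by (intro tendsto_intros LIMSEQ_inverse_real_of_nat)
  then show "(\<lambda>n. 1 - real (a + b) * inverse (real (Suc n))) \<longlonglongrightarrow> 1" by simp
qed (rule tendsto_const)

text \<open>The index is shifted so that the number N = \<open>Suc n\<close> of orbit points is
  positive. All nodes lie in [0, 2 \<pi>), which makes the sequence tight.\<close>

definition (in unitary_pair) fejer_measure :: "'a \<Rightarrow> nat \<Rightarrow> real measure" where
  "fejer_measure x n = distr (point_measure {..<2 * Suc n} (\<lambda>j. ennreal (fejer_weight x (Suc n) j))) borel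
     (\<lambda>j. pi * real j / real (Suc n))"

lemma (in unitary_pair) integral_fejer_measure:
  fixes f :: "real \<Rightarrow> complex"
  assumes [measurable]: "f \<in> borel_measurable borel"
  shows "(LINT s|fejer_measure x n. f s)
    = (\<Sum>j<2 * Suc n. complex_of_real (fejer_weight x (Suc n) j) * f (pi * real j / real (Suc n)))"
  unfolding fejer_measure_def
  by (subst integral_distr)
    (auto simp: measurable_point_measure_eq1 lebesgue_integral_point_measure_finite fejer_weight_nonneg
      scaleR_conv_of_real)

lemma (in unitary_pair) sum_fejer_weight:
  assumes "norm x = 1"
  shows "(\<Sum>j<2 * Suc n. fejer_weight x (Suc n) j) = 1"
proof -
  have "{k. k < Suc n \<and> 0 \<le> 0 + k \<and> 0 + k < 0 + Suc n} = {..<Suc n}" by auto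
  then have "complex_of_real (\<Sum>j<2 * Suc n. fejer_weight x (Suc n) j) = 1"
    using fejer_moment[of "Suc n" 0 0 x] assms by (simp add: cinner_norm)
  then show ?thesis using of_real_eq_1_iff by blast
qed

lemma (in unitary_pair) fejer_measure_1:
  assumes "norm x = 1" and A: "A \<in> sets borel" "{0..<2 * pi} \<subseteq> A"
  shows "emeasure (fejer_measure x n) A = 1"
proof -
  let ?g = "\<lambda>j. pi * real j / real (Suc n)"
  have "?g j \<in> {0..<2 * pi}" if "j < 2 * Suc n" for j
  proof -
    have "real j < 2 * real (Suc n)" using that by linarith
    then have "pi * real j < pi * (2 * real (Suc n))" by simp
    then show ?thesis by (simp add: field_simps del: of_nat_Suc)
  qed
  then have "?g -` A \<inter> {..<2 * Suc n} = {..<2 * Suc n}" using A(2) by blast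
  then have "emeasure (fejer_measure x n) A
      = emeasure (point_measure {..<2 * Suc n} (\<lambda>j. ennreal (fejer_weight x (Suc n) j))) {..<2 * Suc n}"
    unfolding fejer_measure_def using A
    by (subst emeasure_distr) (auto simp: measurable_point_measure_eq1 space_point_measure)
  also have "\<dots> = (\<Sum>j<2 * Suc n. ennreal (fejer_weight x (Suc n) j))"
    by (rule emeasure_point_measure_finite) auto
  also have "\<dots> = 1"
    using sum_fejer_weight[OF assms(1), of n]
    by (subst sum_ennreal) (auto simp: fejer_weight_nonneg)
  finally show ?thesis .
qed

lemma (in unitary_pair) real_distribution_fejer:
  assumes "norm x = 1"
  shows "real_distribution (fejer_measure x n)"
proof (intro real_distribution.intro real_distribution_axioms.intro prob_spaceI)
  show "emeasure (fejer_measure x n) (space (fejer_measure x n)) = 1"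
    using fejer_measure_1[OF assms, of UNIV n] by (simp add: fejer_measure_def)
qed (simp add: fejer_measure_def)

lemma (in unitary_pair) trigonometric_moments:
  assumes x: "norm x = 1"
  obtains M where "real_distribution M"
    "\<And>a b. (LINT s|M. cis s ^ a * cnj (cis s) ^ b) = cinner ((U ^^ b) x) ((U ^^ a) x)"
proof -
  have "tight (fejer_measure x)"
    unfolding tight_def
  proof (intro conjI allI impI real_distribution_fejer[OF x])
    fix e :: real assume "e > 0"
    \<comment> \<open>The node 0 carries mass in general and tightness uses intervals open on the
      left, so the left end is moved to -1.\<close>
    have "measure (fejer_measure x n) {-1<..2 * pi} = 1" for n
      using fejer_measure_1[OF x, of "{-1<..2 * pi}" n] by (simp add: measure_def subset_iff)
    then show "\<exists>a b. a < b \<and> (\<forall>n. 1 - e < measure (fejer_measure x n) {a<..b})"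
      using \<open>e > 0\<close> by (intro exI[of _ "-1"] exI[of _ "2 * pi"]) (auto intro: order.strict_trans[of _ 0])
  qed
  then obtain r M where r: "strict_mono r" and M: "real_distribution M"
    and conv: "weak_conv_m (fejer_measure x \<circ> id \<circ> r) M"
    using tight_imp_convergent_subsubsequence[of "fejer_measure x" id] by (auto simp: strict_mono_id)
  have "(LINT s|M. cis s ^ a * cnj (cis s) ^ b) = cinner ((U ^^ b) x) ((U ^^ a) x)" for a b
  proof (rule LIMSEQ_unique)
    let ?f = "\<lambda>s. cis s ^ a * cnj (cis s) ^ b"
    have f_eq: "?f s = cis ((real a - real b) * s)" for s
      unfolding cis_cnj Complex.DeMoivre cis_mult by (intro arg_cong[where f = cis]) (simp add: algebra_simps)
    have cont: "isCont ?f s" for s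
      unfolding cis_conv_exp by (intro continuous_intros)
    show "(\<lambda>n. LINT s|(fejer_measure x \<circ> id \<circ> r) n. ?f s) \<longlonglongrightarrow> (LINT s|M. ?f s)"
      by (rule weak_conv_imp_integral_bdd_continuous_conv[OF _ M conv cont, where B = 1])
        (auto simp: real_distribution_fejer[OF x] norm_mult norm_power)
    let ?c = "cinner ((U ^^ b) x) ((U ^^ a) x)"
    let ?q = "\<lambda>n. complex_of_real (real (card {k. k < Suc n \<and> b \<le> a + k \<and> a + k < b + Suc n}) / real (Suc n)) * ?c"
    have meas: "?f \<in> borel_measurable borel"
      by (intro borel_measurable_continuous_onI continuous_at_imp_continuous_on ballI cont)
    have "(LINT s|fejer_measure x n. ?f s) = ?q n" if "n \<ge> a + b" for n
      unfolding integral_fejer_measure[OF meas] unfolding f_eq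
      by (rule fejer_moment) (use that in auto)
    then have ev: "\<forall>\<^sub>F n in sequentially. ?q n = (LINT s|fejer_measure x n. ?f s)"
      unfolding eventually_sequentially by (intro exI[of _ "a + b"]) simp
    have "?q \<longlonglongrightarrow> complex_of_real 1 * ?c"
      by (intro tendsto_mult tendsto_of_real fejer_count_tendsto tendsto_const)
    then have "(\<lambda>n. LINT s|fejer_measure x n. ?f s) \<longlonglongrightarrow> ?c"
      using tendsto_cong[OF ev] by simp
    from LIMSEQ_subseq_LIMSEQ[OF this r]
    show "(\<lambda>n. LINT s|(fejer_measure x \<circ> id \<circ> r) n. ?f s) \<longlonglongrightarrow> ?c" by (simp add: comp_def)
  qed
  with M show ?thesis by (rule that)
qed

section \<open>Spectral measures on the line\<close>

lemma borel_measurable_cnj [measurable]: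
  "f \<in> borel_measurable M \<Longrightarrow> (\<lambda>x. cnj (f x)) \<in> borel_measurable M"
  by (rule measurable_compose[OF _ borel_measurable_continuous_onI])
    (auto intro: continuous_intros)

text \<open>For a unitary \<open>U\<close>, density of the range of 1 - U says that 1 is not an
  eigenvalue. This is the property that singles out Cayley transforms of self-adjoint
  operators.\<close>

locale cayley_pair = unitary_pair U U' for U U' :: "'a::complex_hilbert_space \<Rightarrow> 'a" +
  assumes dense: "closure (range (\<lambda>y. y - U y)) = UNIV"

text \<open>On a vector y - U y the orbit sum telescopes and stays bounded by 2 |y|. A general
  \<open>x\<close> is within e/2 of such a vector, and averaging does not enlarge this error; the
  remaining e/2 absorbs 2 |y| / n for large n.\<close>

lemma (in cayley_pair) mean_ergodic:
  "(\<lambda>n. norm (\<Sum>k<Suc n. (U ^^ k) x) / real (Suc n)) \<longlonglongrightarrow> 0"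
proof (rule LIMSEQ_I)
  fix e :: real assume e: "e > 0"
  obtain y where y: "norm (x - (y - U y)) < e / 2"
  proof -
    have "x \<in> closure (range (\<lambda>y. y - U y))" using dense by simp
    then have "\<exists>z\<in>range (\<lambda>y. y - U y). dist z x < e / 2"
      using e unfolding closure_approachable by (meson half_gt_zero)
    then show ?thesis using that by (auto simp: dist_norm norm_minus_commute)
  qed
  have add: "(U ^^ k) (v + w) = (U ^^ k) v + (U ^^ k) w" for k v w
    by (rule bounded_ops_add[OF bounded_ops_power[OF U_ops]])
  have tele: "(\<Sum>k<n. (U ^^ k) (y - U y)) = y - (U ^^ n) y" for n
  proof -
    have "(U ^^ k) (y - U y) = (U ^^ k) y - (U ^^ Suc k) y" for k
      using add[of k "y - U y" "U y"] unfolding funpow_Suc_right comp_apply by (simp add: eq_diff_eq)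
    then show ?thesis by (induction n) simp_all
  qed
  have bound: "norm (\<Sum>k<n. (U ^^ k) x) \<le> real n * (e / 2) + 2 * norm y" for n
  proof -
    have "(U ^^ k) x = (U ^^ k) (x - (y - U y)) + (U ^^ k) (y - U y)" for k
      using add[of k "x - (y - U y)" "y - U y"] by simp
    then have "(\<Sum>k<n. (U ^^ k) x) = (\<Sum>k<n. (U ^^ k) (x - (y - U y))) + (y - (U ^^ n) y)"
      by (simp only: sum.distrib tele)
    also have "norm \<dots> \<le> norm (\<Sum>k<n. (U ^^ k) (x - (y - U y))) + norm (y - (U ^^ n) y)"
      by (rule norm_triangle_ineq)
    also have "norm (\<Sum>k<n. (U ^^ k) (x - (y - U y))) \<le> (\<Sum>k<n. norm ((U ^^ k) (x - (y - U y))))"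
      by (rule norm_sum)
    also have "\<dots> \<le> real n * (e / 2)"
      unfolding norm_pow sum_constant card_lessThan using y by (intro mult_left_mono) auto
    also have "norm (y - (U ^^ n) y) \<le> 2 * norm y"
      using norm_triangle_ineq4[of y "(U ^^ n) y"] by simp
    finally show ?thesis by simp
  qed
  obtain N where N: "2 * norm y < real N * (e / 2)"
    using reals_Archimedean3[OF half_gt_zero[OF e]] by blast
  have "norm (norm (\<Sum>k<Suc n. (U ^^ k) x) / real (Suc n) - 0) < e" if "n \<ge> N" for n
  proof -
    have "real N * (e / 2) \<le> real (Suc n) * (e / 2)" using that e by (intro mult_right_mono) auto
    then have "norm (\<Sum>k<Suc n. (U ^^ k) x) < real (Suc n) * e" using bound[of "Suc n"] N by linarith
    then show ?thesis by (simp add: divide_less_eq mult.commute del: of_nat_Suc sum.lessThan_Suc)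
  qed
  then show "\<exists>N. \<forall>n\<ge>N. norm (norm (\<Sum>k<Suc n. (U ^^ k) x) / real (Suc n) - 0) < e" by blast
qed

text \<open>The sum of the first n powers of cis s equals n where cis s = 1, so the mass there is at
  most the integral of |p n|^2 / n^2. The moments turn this integral into the squared norm of an
  ergodic average.\<close>

lemma (in cayley_pair) no_mass_at_1:
  assumes M: "real_distribution M"
    and moments: "\<And>a b. (LINT s|M. cis s ^ a * cnj (cis s) ^ b) = cinner ((U ^^ b) x) ((U ^^ a) x)"
  shows "AE s in M. cis s \<noteq> 1"
proof -
  interpret real_distribution M by (rule M)
  let ?A = "{s. cis s = 1}"
  have cis_cont: "continuous_on UNIV cis"
    unfolding cis_conv_exp by (intro continuous_intros)
  have cis_meas [measurable]: "cis \<in> borel_measurable borel"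
    by (rule borel_measurable_continuous_onI[OF cis_cont])
  have A [measurable]: "?A \<in> sets borel"
    by (intro borel_closed closed_Collect_eq cis_cont continuous_on_const)
  define p where "p n s = (\<Sum>k<n. cis s ^ k)" for n s
  have p_meas [measurable]: "p n \<in> borel_measurable borel" for n
    unfolding p_def by measurable
  have p_le: "cmod (p n s) \<le> real n" for n s
    unfolding p_def by (rule order_trans[OF norm_sum]) (simp add: norm_power)
  have mono_int: "integrable M (\<lambda>s. cis s ^ a * cnj (cis s) ^ b)" for a b
    by (rule integrable_const_bound[of _ 1]) (auto simp: norm_mult norm_power)
  have norm_p: "(LINT s|M. (cmod (p n s))\<^sup>2) = (norm (\<Sum>k<n. (U ^^ k) x))\<^sup>2" for n
  proof -
    have "complex_of_real ((cmod (p n s))\<^sup>2) = (\<Sum>k<n. \<Sum>l<n. cis s ^ k * cnj (cis s) ^ l)" for s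
      unfolding complex_norm_square p_def by (simp add: sum_product)
    then have "complex_of_real (LINT s|M. (cmod (p n s))\<^sup>2) = (LINT s|M. (\<Sum>k<n. \<Sum>l<n. cis s ^ k * cnj (cis s) ^ l))"
      by (simp only: integral_complex_of_real[symmetric])
    also have "\<dots> = (\<Sum>k<n. \<Sum>l<n. LINT s|M. cis s ^ k * cnj (cis s) ^ l)"
      by (subst Bochner_Integration.integral_sum, intro Bochner_Integration.integrable_sum mono_int,
          intro sum.cong refl Bochner_Integration.integral_sum mono_int)
    also have "\<dots> = (\<Sum>k<n. \<Sum>l<n. cinner ((U ^^ l) x) ((U ^^ k) x))" unfolding moments ..
    also have "\<dots> = cinner (\<Sum>k<n. (U ^^ k) x) (\<Sum>k<n. (U ^^ k) x)"
      unfolding cinner.sum_right cinner.sum_left ..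
    also have "\<dots> = complex_of_real ((norm (\<Sum>k<n. (U ^^ k) x))\<^sup>2)" by (rule cinner_norm)
    finally show ?thesis using of_real_eq_iff by blast
  qed
  have "measure M ?A \<le> (norm (\<Sum>k<Suc n. (U ^^ k) x) / real (Suc n))\<^sup>2" for n
  proof -
    have "measure M ?A = (LINT s|M. indicator ?A s)" by simp
    also have "\<dots> \<le> (LINT s|M. (cmod (p (Suc n) s))\<^sup>2 / (real (Suc n))\<^sup>2)"
    proof (rule integral_mono)
      show "integrable M (indicator ?A :: real \<Rightarrow> real)" by (simp add: emeasure_eq_measure)
      have "(cmod (p (Suc n) s))\<^sup>2 / (real (Suc n))\<^sup>2 \<le> 1" for s
        using power_mono[OF p_le[of "Suc n" s], of 2] by (simp del: of_nat_Suc)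
      then show "integrable M (\<lambda>s. (cmod (p (Suc n) s))\<^sup>2 / (real (Suc n))\<^sup>2)"
        by (intro integrable_const_bound[of _ 1]) auto
      show "indicator ?A s \<le> (cmod (p (Suc n) s))\<^sup>2 / (real (Suc n))\<^sup>2" for s
      proof (cases "cis s = 1")
        case True
        then have "p (Suc n) s = of_nat (Suc n)" by (simp add: p_def)
        then have "cmod (p (Suc n) s) = real (Suc n)" by (metis norm_of_nat)
        then show ?thesis by (simp del: of_nat_Suc)
      qed simp
    qed
    also have "\<dots> = (norm (\<Sum>k<Suc n. (U ^^ k) x))\<^sup>2 / (real (Suc n))\<^sup>2"
      by (simp only: integral_divide_zero norm_p)
    finally show ?thesis by (simp only: power_divide)
  qed
  moreover have "(\<lambda>n. (norm (\<Sum>k<Suc n. (U ^^ k) x) / real (Suc n))\<^sup>2) \<longlonglongrightarrow> 0"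
    using tendsto_power[OF mean_ergodic, where n = 2] unfolding zero_power2 .
  ultimately have "measure M ?A \<le> 0"
    using LIMSEQ_le_const by blast
  then have "emeasure M ?A = 0" by (simp add: emeasure_eq_measure measure_le_0_iff)
  then show ?thesis
    by (intro AE_I[of _ _ ?A]) auto
qed

section \<open>The Cayley transform between the line and the circle without 1\<close>

definition cayley :: "real \<Rightarrow> complex" where
  "cayley l = (complex_of_real l - \<i>) / (complex_of_real l + \<i>)"

lemma of_real_plus_i_neq_0 [simp]: "complex_of_real l + \<i> \<noteq> 0" "complex_of_real l - \<i> \<noteq> 0"
  by (auto simp: complex_eq_iff)

lemma norm_cayley [simp]: "cmod (cayley l) = 1"
proof -
  have "cmod (complex_of_real l - \<i>) = cmod (complex_of_real l + \<i>)" by (simp add: cmod_def)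
  then show ?thesis by (simp add: cayley_def norm_divide)
qed

lemma cayley_measurable [measurable]: "cayley \<in> borel_measurable borel"
  unfolding cayley_def by (intro borel_measurable_continuous_onI continuous_intros) simp

text \<open>The inverse Cayley transform \<open>\<i> (1 + z) / (1 - z)\<close> of \<open>z = cis s\<close> is \<open>- sin s / (1 - cos s)\<close>.\<close>

lemma cayley_cis:
  assumes "cis s \<noteq> 1"
  shows "cayley (- sin s / (1 - cos s)) = cis s"
proof -
  have c: "1 - cos s \<noteq> 0"
  proof
    assume "1 - cos s = 0"
    then have "cos s = 1" by simp
    then have "sin s = 0" using sin_cos_squared_add[of s] by simp
    with \<open>cos s = 1\<close> assms show False by (simp add: complex_eq_iff)
  qed
  define l where "l = - sin s / (1 - cos s)"
  have l: "l * (1 - cos s) = - sin s" using c by (simp add: l_def)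
  have "complex_of_real l - \<i> = cis s * (complex_of_real l + \<i>)"
  proof (rule complex_eqI)
    show "Re (complex_of_real l - \<i>) = Re (cis s * (complex_of_real l + \<i>))"
      using l by (simp add: algebra_simps)
    have "(l * sin s + cos s) * (1 - cos s) = (- 1) * (1 - cos s)"
    proof -
      have "(l * sin s + cos s) * (1 - cos s) = (l * (1 - cos s)) * sin s + cos s * (1 - cos s)"
        by (simp add: algebra_simps)
      also have "\<dots> = - (sin s * sin s + cos s * cos s) + cos s"
        unfolding l by (simp add: algebra_simps)
      also have "sin s * sin s + cos s * cos s = 1"
        using sin_cos_squared_add[of s] by (simp add: power2_eq_square)
      finally show ?thesis by simp
    qed
    then have "l * sin s + cos s = - 1" using c by (simp only: mult_cancel_right) simp
    then show "Im (complex_of_real l - \<i>) = Im (cis s * (complex_of_real l + \<i>))"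
      by (simp add: algebra_simps)
  qed
  then show ?thesis unfolding cayley_def l_def[symmetric] by simp
qed

lemma (in cayley_pair) cayley_moments_unit:
  assumes x: "norm x = 1"
  obtains M where "finite_measure M" "sets M = sets borel"
    "\<And>a b. (LINT l|M. cayley l ^ a * cnj (cayley l) ^ b) = cinner ((U ^^ b) x) ((U ^^ a) x)"
proof -
  obtain M where M: "real_distribution M"
    and moments: "\<And>a b. (LINT s|M. cis s ^ a * cnj (cis s) ^ b) = cinner ((U ^^ b) x) ((U ^^ a) x)"
    using trigonometric_moments[OF x] by blast
  interpret real_distribution M by (rule M)
  \<comment> \<open>Where cis s = 1 the denominator vanishes and \<open>?g\<close> takes the default
    value 0; these points form a null set of \<open>M\<close>.\<close>
  let ?g = "\<lambda>s. - sin s / (1 - cos s) :: real"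
  have g [measurable]: "?g \<in> borel_measurable borel"
    by (intro borel_measurable_divide borel_measurable_diff borel_measurable_uminus borel_measurable_const
        borel_measurable_continuous_onI continuous_intros)
  have cis_meas [measurable]: "cis \<in> borel_measurable borel"
    unfolding cis_conv_exp by (intro borel_measurable_continuous_onI continuous_intros)
  show ?thesis
  proof (rule that)
    show "finite_measure (distr M borel ?g)" by (rule finite_measure_distr) simp
    show "sets (distr M borel ?g) = sets borel" by simp
    fix a b
    have "(LINT l|distr M borel ?g. cayley l ^ a * cnj (cayley l) ^ b) = (LINT s|M. cayley (?g s) ^ a * cnj (cayley (?g s)) ^ b)"
      by (rule integral_distr) simp_all
    also have "\<dots> = (LINT s|M. cis s ^ a * cnj (cis s) ^ b)"
    proof (rule integral_cong_AE)
      show "AE s in M. cayley (?g s) ^ a * cnj (cayley (?g s)) ^ b = cis s ^ a * cnj (cis s) ^ b"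
        using no_mass_at_1[OF M moments]
      proof eventually_elim
        case (elim s)
        show ?case by (simp only: cayley_cis[OF elim])
      qed
    qed simp_all
    finally show "(LINT l|distr M borel ?g. cayley l ^ a * cnj (cayley l) ^ b) = cinner ((U ^^ b) x) ((U ^^ a) x)"
      by (simp only: moments)
  qed
qed

lemma (in cayley_pair) cayley_moments:
  "\<exists>M. finite_measure M \<and> sets M = sets borel \<and>
    (\<forall>a b. (LINT l|M. cayley l ^ a * cnj (cayley l) ^ b) = cinner ((U ^^ b) x) ((U ^^ a) x))"
proof (cases "x = 0")
  case True
  have "(U ^^ n) 0 = 0" for n
    using bounded_ops_add[OF bounded_ops_power[OF U_ops], of n 0 0] by simp
  moreover have "finite_measure (null_measure (borel :: real measure))" by (rule finite_measureI) simp
  ultimately show ?thesis using True by (intro exI[of _ "null_measure borel"]) (simp add: cinner.zero_left)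
next
  case False
  define e where "e = complex_of_real (inverse (norm x)) *\<^sub>C x"
  have "norm e = 1" using False by (simp add: e_def norm_scaleC norm_inverse)
  then obtain M where M: "finite_measure M" "sets M = sets borel"
    and moments: "\<And>a b. (LINT l|M. cayley l ^ a * cnj (cayley l) ^ b) = cinner ((U ^^ b) e) ((U ^^ a) e)"
    using cayley_moments_unit by blast
  have xe: "x = complex_of_real (norm x) *\<^sub>C e"
    using False by (simp add: e_def scaleC_scaleC flip: of_real_mult)
  have Ux: "(U ^^ n) x = complex_of_real (norm x) *\<^sub>C (U ^^ n) e" for n
    by (subst xe) (rule bounded_ops_scaleC[OF bounded_ops_power[OF U_ops]])
  \<comment> \<open>The moments are quadratic in the vector, so undoing the normalization multiplies
    the measure by |x|^2.\<close>
  let ?M = "density M (\<lambda>_. (norm x)\<^sup>2)"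
  have sp: "space M = UNIV" using sets_eq_imp_space_eq[OF M(2)] by simp
  show ?thesis
  proof (intro exI[of _ ?M] conjI allI)
    show "finite_measure ?M"
      using finite_measure.emeasure_finite[OF M(1), of UNIV] sp
      by (intro finite_measureI) (auto simp: emeasure_density_const sets.top M(2) ennreal_mult_eq_top_iff)
    show "sets ?M = sets borel" using M(2) by simp
    fix a b
    have "(\<lambda>l. cayley l ^ a * cnj (cayley l) ^ b) \<in> borel_measurable M"
      unfolding measurable_cong_sets[OF M(2) refl] by measurable
    then have "(LINT l|?M. cayley l ^ a * cnj (cayley l) ^ b) = (LINT l|M. (norm x)\<^sup>2 *\<^sub>R (cayley l ^ a * cnj (cayley l) ^ b))"
      by (rule integral_density) auto
    also have "\<dots> = (norm x)\<^sup>2 *\<^sub>R cinner ((U ^^ b) e) ((U ^^ a) e)"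
      by (simp only: integral_scaleR_right moments)
    also have "\<dots> = cinner ((U ^^ b) x) ((U ^^ a) x)"
      unfolding Ux cinner_scaleC_left cinner_scaleC_right
      by (simp add: scaleR_conv_of_real power2_eq_square)
    finally show "(LINT l|?M. cayley l ^ a * cnj (cayley l) ^ b) = cinner ((U ^^ b) x) ((U ^^ a) x)" .
  qed
qed

definition (in cayley_pair) \<nu> :: "'a \<Rightarrow> real measure" where
  "\<nu> x = (SOME M. finite_measure M \<and> sets M = sets borel \<and>
    (\<forall>a b. (LINT l|M. cayley l ^ a * cnj (cayley l) ^ b) = cinner ((U ^^ b) x) ((U ^^ a) x)))"

lemma (in cayley_pair)
  finite_measure_\<nu>: "finite_measure (\<nu> x)" and sets_\<nu>: "sets (\<nu> x) = sets borel"
    and moments_\<nu>: "(LINT l|\<nu> x. cayley l ^ a * cnj (cayley l) ^ b) = cinner ((U ^^ b) x) ((U ^^ a) x)"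
  using someI_ex[OF cayley_moments[of x]] unfolding \<nu>_def[symmetric] by blast+

text \<open>The pair of exponents is not reduced to one integer although \<open>cayley l\<close> has
  modulus 1. Products then simply add exponents, and conjugation swaps them.\<close>

definition monomial_triple ::
  "('a \<Rightarrow> 'a) \<Rightarrow> ('a \<Rightarrow> 'a) \<Rightarrow> (real \<Rightarrow> complex) \<Rightarrow> ('a \<Rightarrow> 'a) \<Rightarrow> ('a \<Rightarrow> 'a) \<Rightarrow> bool" where
  "monomial_triple U U' f T S \<longleftrightarrow> (\<exists>a b. f = (\<lambda>l. cayley l ^ a * cnj (cayley l) ^ b) \<and>
     T = (U ^^ a) \<circ> (U' ^^ b) \<and> S = (U ^^ b) \<circ> (U' ^^ a))"

lemma (in unitary_pair) pow_commute: "(U ^^ a) ((U' ^^ b) x) = (U' ^^ b) ((U ^^ a) x)"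
proof -
  have 1: "U ((U' ^^ b) y) = (U' ^^ b) (U y)" for y
    by (induction b arbitrary: y) (simp_all add: funpow_swap1)
  show ?thesis by (induction a) (simp_all add: 1)
qed

lemma (in cayley_pair) operator_calculus_cayley: "operator_calculus \<nu> (monomial_triple U U')"
proof (rule operator_calculus.intro)
  fix x y :: 'a and f g :: "real \<Rightarrow> complex" and T S T' S' :: "'a \<Rightarrow> 'a"
  show "finite_measure (\<nu> x)" by (rule finite_measure_\<nu>)
  show "sets (\<nu> x) = sets borel" by (rule sets_\<nu>)
  show "monomial_triple U U' (\<lambda>_. 1) id id"
    unfolding monomial_triple_def by (intro exI[of _ 0]) auto
  assume "monomial_triple U U' f T S"
  then obtain a b where ab: "f = (\<lambda>l. cayley l ^ a * cnj (cayley l) ^ b)"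
     "T = (U ^^ a) \<circ> (U' ^^ b)" "S = (U ^^ b) \<circ> (U' ^^ a)"
    by (auto simp: monomial_triple_def)
  show "f \<in> borel_measurable borel" unfolding ab(1) by measurable
  show "\<exists>K. \<forall>l. cmod (f l) \<le> K" unfolding ab(1) by (intro exI[of _ 1]) (simp add: norm_mult norm_power)
  show "T \<in> bounded_ops" unfolding ab(2) by (intro bounded_ops_comp bounded_ops_power U_ops U'_ops)
  have adj': "cinner ((U' ^^ n) v) w = cinner v ((U ^^ n) w)" for n v w
    using cinner_pow_left[of n w v] by (metis cinner_commute)
  show "cinner (T x) y = cinner x (S y)"
    unfolding ab by (simp add: cinner_pow_left adj')
  show "cinner x (T x) = (LINT l|\<nu> x. f l)"
    unfolding ab moments_\<nu> by (simp add: pow_commute cinner_pow_left)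
  show "monomial_triple U U' (\<lambda>l. cnj (f l)) S T"
    unfolding monomial_triple_def ab by (rule exI[of _ b], rule exI[of _ a]) (simp add: mult.commute)
  assume "monomial_triple U U' g T' S'"
  then obtain c d where cd: "g = (\<lambda>l. cayley l ^ c * cnj (cayley l) ^ d)"
     "T' = (U ^^ c) \<circ> (U' ^^ d)" "S' = (U ^^ d) \<circ> (U' ^^ c)"
    by (auto simp: monomial_triple_def)
  show "monomial_triple U U' (\<lambda>l. f l * g l) (T \<circ> T') (S' \<circ> S)"
    unfolding monomial_triple_def
  proof (rule exI[of _ "a + c"], rule exI[of _ "b + d"], intro conjI)
    show "(\<lambda>l. f l * g l) = (\<lambda>l. cayley l ^ (a + c) * cnj (cayley l) ^ (b + d))"
      unfolding ab cd by (simp add: power_add mult_ac)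
    show "T \<circ> T' = (U ^^ (a + c)) \<circ> (U' ^^ (b + d))" "S' \<circ> S = (U ^^ (b + d)) \<circ> (U' ^^ (a + c))"
      unfolding ab cd add.commute[of b d] add.commute[of a c]
      by (auto simp: fun_eq_iff funpow_add pow_commute)
        (metis comp_apply funpow_add add.commute pow_commute)+
  qed
qed

sublocale cayley_pair \<subseteq> operator_calculus \<nu> "monomial_triple U U'"
  by (rule operator_calculus_cayley)

lemma cayley_Re_Im: "Re (cayley l) = 1 - 2 / (1 + l\<^sup>2)" "Im (cayley l) = - 2 * l / (1 + l\<^sup>2)"
proof -
  define w where "w = 1 / (1 + l\<^sup>2)"
  have "1 + l\<^sup>2 > 0" by (metis add_pos_nonneg zero_le_power2 zero_less_one)
  then have "w * (1 + l\<^sup>2) = 1" by (simp add: w_def)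
  then have w: "w + w * (l * l) = 1" by (simp add: algebra_simps power2_eq_square)
  have "complex_of_real l - \<i> = Complex (1 - 2 * w) (- 2 * l * w) * (complex_of_real l + \<i>)"
    using w by (intro complex_eqI) (simp_all add: algebra_simps)
  then have "cayley l = Complex (1 - 2 * w) (- 2 * l * w)"
    by (simp add: cayley_def)
  then show "Re (cayley l) = 1 - 2 / (1 + l\<^sup>2)" "Im (cayley l) = - 2 * l / (1 + l\<^sup>2)"
    by (simp_all add: w_def)
qed

text \<open>The real and imaginary parts of \<open>cayley\<close> give p = 1 / (1 + l^2) and q = l /
  (1 + l^2), whose quotient is l. As 1 / p is unbounded, it is truncated by applying the continuous
  function \<open>h n\<close> to p; at each fixed l the product q h n(p) equals l from some n
  on.\<close>

lemma (in cayley_pair) calc_exists: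
  assumes f: "f \<in> borel_measurable borel" "\<And>l. cmod (f l) \<le> K"
  shows "\<exists>T S. calc f T S"
proof -
  let ?D = "{f. \<exists>T S. calc f T S}"
  interpret D: bounded_limit_algebra ?D by (rule bounded_limit_algebra_calc)
  have mono: "(\<lambda>l. cayley l ^ a * cnj (cayley l) ^ b) \<in> ?D" for a b
    using calc.base[of "\<lambda>l. cayley l ^ a * cnj (cayley l) ^ b"] unfolding monomial_triple_def by blast
  have u: "cayley \<in> ?D" "(\<lambda>l. cnj (cayley l)) \<in> ?D" using mono[of 1 0] mono[of 0 1] by simp_all
  define p where "p l = 1 / (1 + l\<^sup>2)" for l :: real
  define q where "q l = l / (1 + l\<^sup>2)" for l :: real
  have pos: "1 + l\<^sup>2 > 0" for l :: real by (metis add_pos_nonneg zero_le_power2 zero_less_one)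
  have Re: "Re (cayley l) = 1 - 2 * p l" and Im: "Im (cayley l) = - 2 * q l" for l
    by (simp_all add: cayley_Re_Im p_def q_def)
  have p_eq: "complex_of_real (p l) = (1 / 2) + (- 1 / 4) * (cayley l + cnj (cayley l))"
    and q_eq: "complex_of_real (q l) = (\<i> / 4) * (cayley l - cnj (cayley l))" for l
    by (simp_all add: complex_eq_iff Re Im field_simps)
  have pD: "(\<lambda>l. complex_of_real (p l)) \<in> ?D"
    unfolding p_eq by (intro D.add D.mult D.const u)
  have qD: "(\<lambda>l. complex_of_real (q l)) \<in> ?D"
    unfolding q_eq by (intro D.diff D.mult D.const u)
  have p1: "\<bar>p l\<bar> \<le> 1" for l using pos[of l] by (simp add: p_def)
  have q1: "\<bar>q l\<bar> \<le> 1" for l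
  proof -
    \<comment> \<open>The right-hand side expands to 1 - |l| + l^2.\<close>
    have "0 \<le> (1 - \<bar>l\<bar>)\<^sup>2 + \<bar>l\<bar>" by simp
    then have "\<bar>l\<bar> \<le> 1 + l\<^sup>2" by (simp add: power2_eq_square algebra_simps flip: abs_mult)
    then show ?thesis using pos[of l] by (simp add: q_def)
  qed
  define h where "h n y = 1 / max y (inverse (real (Suc n)))" for n and y :: real
  have mx: "max y (inverse (real (Suc n))) > 0" for n y by (simp add: less_max_iff_disj)
  have h_cont: "continuous_on UNIV (h n)" for n
    unfolding h_def using mx by (intro continuous_intros) (auto simp: less_imp_neq[symmetric])
  have h_le: "\<bar>h n y\<bar> \<le> real (Suc n)" for n y
  proof -
    have "inverse (max y (inverse (real (Suc n)))) \<le> inverse (inverse (real (Suc n)))"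
      by (intro le_imp_inverse_le) auto
    then show ?thesis using mx[of y n] by (simp add: h_def divide_inverse del: of_nat_Suc)
  qed
  define s where "s n l = q l * h n (p l)" for n l
  have "(\<lambda>l. complex_of_real (s n l)) \<in> ?D" for n
    unfolding s_def of_real_mult by (intro D.mult qD D.continuous_comp[OF pD p1 h_cont])
  moreover have "\<bar>s n l\<bar> \<le> 1 * real (Suc n)" for n l
    unfolding s_def abs_mult by (intro mult_mono q1 h_le) auto
  moreover have "(\<lambda>n. s n l) \<longlonglongrightarrow> l" for l
  proof -
    have pl: "p l > 0" using pos[of l] by (simp add: p_def)
    then obtain N where N: "inverse (real (Suc N)) < p l" using reals_Archimedean by blast
    have "s n l = l" if "n \<ge> N" for n
    proof -
      have "inverse (real (Suc n)) \<le> inverse (real (Suc N))"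
        using that by (intro le_imp_inverse_le) auto
      then have "max (p l) (inverse (real (Suc n))) = p l" using N by (intro max_absorb1) linarith
      then show ?thesis using pos[of l] by (simp add: s_def h_def p_def q_def)
    qed
    then have "\<forall>\<^sub>F n in sequentially. s n l = l" unfolding eventually_sequentially by blast
    then show ?thesis by (rule tendsto_eventually)
  qed
  ultimately have "(\<lambda>l. indicator B l) \<in> ?D" if "B \<in> sets borel" for B
    using that by (rule D.indicator_mem)
  then have "f \<in> ?D" using f by (rule D.bounded_measurable)
  then show ?thesis by blast
qed

section \<open>The projection-valued measure obtained from the Cayley transform\<close>

definition (in cayley_pair) spectral :: "real set \<Rightarrow> 'a \<Rightarrow> 'a" where
  "spectral B = (SOME T. \<exists>S. calc (indicator B) T S)"

lemma (in cayley_pair) calc_spectral_ex: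
  assumes "B \<in> sets borel"
  shows "\<exists>S. calc (indicator B) (spectral B) S"
proof -
  have "\<exists>T S. calc (indicator B) T S"
    using assms by (intro calc_exists[of _ 1]) (auto simp: indicator_def)
  then show ?thesis unfolding spectral_def by (rule someI_ex)
qed

text \<open>An indicator is real, so swapping the two components of its triple gives a second triple
  for the same function; uniqueness then makes the operator self-adjoint.\<close>

lemma (in cayley_pair) calc_spectral:
  assumes B: "B \<in> sets borel"
  shows "calc (indicator B) (spectral B) (spectral B)"
proof -
  obtain S where S: "calc (indicator B) (spectral B) S" using calc_spectral_ex[OF B] by blast
  have "(\<lambda>l. cnj (indicator B l)) = indicator B" by (auto simp: indicator_def)
  then have "calc (indicator B) S (spectral B)" using calc_cnj[OF S] by simp
  then show ?thesis using calc_unique S by blast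
qed

lemma (in cayley_pair) projection_measure_spectral: "projection_measure spectral"
proof (unfold_locales, unfold projection_valued_measure_def, intro conjI ballI allI impI)
  fix B :: "real set" assume B: "B \<in> sets borel"
  have "calc (indicator B) (spectral B \<circ> spectral B) (spectral B \<circ> spectral B)"
    using calc_mult[OF calc_spectral[OF B] calc_spectral[OF B]]
    by (simp add: indicator_inter_arith[symmetric] fun_eq_iff)
  then have "spectral B \<circ> spectral B = spectral B" using calc_unique calc_spectral[OF B] by blast
  then show "orthogonal_projection (spectral B)"
    unfolding orthogonal_projection_def
    using calc_bounded_ops[OF calc_spectral[OF B]] calc_adjoint[OF calc_spectral[OF B]] by blast
next
  have "calc (\<lambda>_. 0) (\<lambda>x. 0) (\<lambda>x. 0)"
    using calc.scale[OF calc.base[OF base_one], of 0] by (simp add: scaleC.zero_left)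
  moreover have "calc (\<lambda>_. 0) (spectral {}) (spectral {})"
    using calc_spectral[of "{}"] by (simp add: indicator_def[abs_def])
  ultimately show "spectral {} = (\<lambda>x. 0)" using calc_unique by blast
  have "calc (\<lambda>_. 1) (spectral UNIV) (spectral UNIV)"
    using calc_spectral[of UNIV] by (simp add: indicator_def[abs_def])
  then show "spectral UNIV = id" using calc_unique calc.base[OF base_one] by blast
next
  fix A B :: "real set" assume A: "A \<in> sets borel" and B: "B \<in> sets borel"
  have "indicator (A \<inter> B) = (\<lambda>l. indicator A l * indicator B l :: complex)"
    by (auto simp: indicator_def)
  then have "calc (indicator (A \<inter> B)) (spectral A \<circ> spectral B) (spectral B \<circ> spectral A)"
    using calc_mult[OF calc_spectral[OF B] calc_spectral[OF A]] by simp
  then show "spectral (A \<inter> B) = spectral A \<circ> spectral B"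
    using calc_unique[OF calc_spectral[OF sets.Int[OF A B]]] by blast
next
  fix A :: "nat \<Rightarrow> real set" and x
  assume range: "range A \<subseteq> sets borel" and disj: "disjoint_family A"
  then have A: "A n \<in> sets borel" for n by auto
  define P where "P n = (\<lambda>x. \<Sum>i<n. spectral (A i) x)" for n
  have P: "calc (\<lambda>l. \<Sum>i<n. indicator (A i) l) (P n) (P n)" for n
  proof (induction n)
    case 0
    show ?case unfolding P_def
      using calc.scale[OF calc.base[OF base_one], of 0] by (simp add: scaleC.zero_left)
  next
    case (Suc n)
    show ?case using calc.add[OF Suc calc_spectral[OF A]] by (simp add: P_def)
  qed
  \<comment> \<open>Disjointness keeps the partial sums bounded by 1, so strong countable additivity
    is an instance of the bounded limit theorem.\<close>
  have ind: "(\<Sum>i<n. indicator (A i) l) = (indicator (\<Union>i<n. A i) l :: complex)" for n l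
    by (rule indicator_UN_disjoint[symmetric])
      (use disj in \<open>auto simp: disjoint_family_on_def\<close>)
  obtain T S where T: "calc (indicator (\<Union>i. A i)) T S" "\<And>x. (\<lambda>n. P n x) \<longlonglongrightarrow> T x"
  proof (rule calc_limE[OF P, where K = 1 and f = "indicator (\<Union>i. A i)"])
    show "cmod (\<Sum>i<n. indicator (A i) l) \<le> 1" for n l
      unfolding ind by (simp add: indicator_def)
    show "(\<lambda>n. \<Sum>i<n. indicator (A i) l) \<longlonglongrightarrow> (indicator (\<Union>i. A i) l :: complex)" for l
      unfolding ind by (rule LIMSEQ_indicator_UN)
  qed blast
  have "T = spectral (\<Union>i. A i)"
    using A by (intro calc_unique[OF T(1) calc_spectral]) auto
  then show "(\<lambda>n. spectral (A n) x) sums spectral (\<Union>n. A n) x"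
    using T(2)[of x] unfolding sums_def P_def by simp
qed

lemma (in cayley_pair) emeasure_\<nu>:
  assumes B: "B \<in> sets borel"
  shows "emeasure (\<nu> x) B = ennreal ((norm (spectral B x))\<^sup>2)"
proof -
  have "(\<lambda>l. (cmod (indicator B l))\<^sup>2) = indicator B" by (auto simp: indicator_def)
  then have "(norm (spectral B x))\<^sup>2 = measure (\<nu> x) B"
    using calc_norm[OF calc_spectral[OF B], of x] by simp
  then show ?thesis by (simp add: finite_measure.emeasure_eq_measure[OF finite_\<mu>])
qed

text \<open>The moment measures, chosen arbitrarily for each vector, turn out to be the scalar
  measures of \<open>spectral\<close>; integrals in the definition of a spectral measure can thus be
  computed with \<open>\<nu>\<close>.\<close>

lemma (in cayley_pair) scalar_measure_spectral: "scalar_measure spectral x = \<nu> x"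
proof -
  interpret P: projection_measure spectral by (rule projection_measure_spectral)
  show ?thesis
    by (rule measure_eqI) (simp_all add: sets_\<mu> P.emeasure_scalar_measure emeasure_\<nu>)
qed

text \<open>By multiplicativity \<open>spectral B \<circ> T\<close> represents the product of
  \<open>f\<close> with the indicator of B, and the isometry evaluates its squared norm at x. The
  intended \<open>T\<close> is the resolvent.\<close>

lemma (in cayley_pair) \<nu>_calc:
  assumes f: "calc f T S"
  shows "\<nu> (T x) = density (\<nu> x) (\<lambda>l. ennreal ((cmod (f l))\<^sup>2))"
proof (rule measure_eqI)
  note [measurable] = measurable_\<mu>[OF calc_measurable[OF f], of x]
  fix B assume "B \<in> sets (\<nu> (T x))"
  then have B: "B \<in> sets borel" by (simp add: sets_\<mu>)
  then have [measurable]: "B \<in> sets (\<nu> x)" by (simp add: sets_\<mu>)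
  have int: "integrable (\<nu> x) (\<lambda>l. (cmod (f l))\<^sup>2 * indicator B l)"
  proof -
    obtain K where K: "\<And>l. cmod (f l) \<le> K" using calc_bounded[OF f] by blast
    have K2: "(cmod (f l))\<^sup>2 \<le> K\<^sup>2" for l by (intro power_mono K norm_ge_zero)
    show ?thesis
    proof (rule finite_measure.integrable_const_bound[OF finite_\<mu>, of _ "K\<^sup>2"])
      show "AE l in \<nu> x. norm ((cmod (f l))\<^sup>2 * indicator B l) \<le> K\<^sup>2"
        using K2 by (intro AE_I2) (auto simp: indicator_def)
    qed measurable
  qed
  have "emeasure (\<nu> (T x)) B = ennreal ((norm ((spectral B \<circ> T) x))\<^sup>2)"
    by (simp add: emeasure_\<nu>[OF B])
  also have "(norm ((spectral B \<circ> T) x))\<^sup>2 = (LINT l|\<nu> x. (cmod (indicator B l * f l))\<^sup>2)"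
    by (rule calc_norm[OF calc_mult[OF f calc_spectral[OF B]]])
  also have "\<dots> = (LINT l|\<nu> x. (cmod (f l))\<^sup>2 * indicator B l)"
    by (intro Bochner_Integration.integral_cong) (auto simp: indicator_def)
  also have "ennreal \<dots> = (\<integral>\<^sup>+l. ennreal ((cmod (f l))\<^sup>2 * indicator B l) \<partial>\<nu> x)"
    using int by (intro nn_integral_eq_integral[symmetric]) auto
  also have "\<dots> = (\<integral>\<^sup>+l. ennreal ((cmod (f l))\<^sup>2) * indicator B l \<partial>\<nu> x)"
    by (intro nn_integral_cong) (auto simp: indicator_def)
  also have "\<dots> = emeasure (density (\<nu> x) (\<lambda>l. ennreal ((cmod (f l))\<^sup>2))) B"
    by (rule emeasure_density[symmetric]) measurable
  finally show "emeasure (\<nu> (T x)) B = emeasure (density (\<nu> x) (\<lambda>l. ennreal ((cmod (f l))\<^sup>2))) B" .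
qed (simp add: sets_\<mu>)

section \<open>The spectral theorem for self-adjoint operators\<close>

lemma dense_cinner_eqI:
  fixes D :: "'a::complex_hilbert_space set"
  assumes dense: "closure D = UNIV" and eq: "\<And>x. x \<in> D \<Longrightarrow> cinner x z = cinner x z'"
  shows "z = z'"
proof (rule cinner_eqI)
  fix y
  have "closed {x. cinner x z = cinner x z'}"
    by (intro closed_Collect_eq linear_continuous_on cinner.bounded_linear_left)
  then have "closure D \<subseteq> {x. cinner x z = cinner x z'}" using eq by (intro closure_minimal) auto
  then show "cinner y z = cinner y z'" using dense by auto
qed

locale self_adjoint_operator =
  fixes V :: "'a::complex_hilbert_space \<rightharpoonup> 'a"
  assumes sa: "self_adjoint V"

lemma (in self_adjoint_operator) dense_dom: "closure (dom V) = UNIV"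
  using sa by (simp add: self_adjoint_def)

lemma (in self_adjoint_operator) V_0: "V 0 = Some 0"
  and V_add: "V x = Some x' \<Longrightarrow> V y = Some y' \<Longrightarrow> V (x + y) = Some (x' + y')"
  and V_scaleC: "V x = Some x' \<Longrightarrow> V (c *\<^sub>C x) = Some (c *\<^sub>C x')"
proof -
  have lin: "linear_operator V" using sa by (simp add: self_adjoint_def)
  then show "V x = Some x' \<Longrightarrow> V y = Some y' \<Longrightarrow> V (x + y) = Some (x' + y')"
    and scale: "V x = Some x' \<Longrightarrow> V (c *\<^sub>C x) = Some (c *\<^sub>C x')" for x x' y y' c
    by (force simp: linear_operator_def)+
  obtain z where "V 0 = Some z" using lin by (auto simp: linear_operator_def)
  from scale[OF this, of 0] show "V 0 = Some 0" by (simp add: scaleC.zero_left)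
qed

text \<open>Self-adjointness as a maximality property: a vector satisfying the adjoint relation
  belongs to the domain. It is the tool for showing that \<open>V\<close> is closed and for handling
  the orthogonal complement of a range.\<close>

lemma (in self_adjoint_operator) V_eq_SomeI:
  assumes z: "\<And>x x'. V x = Some x' \<Longrightarrow> cinner x' y = cinner x z"
  shows "V y = Some z"
proof -
  have adj: "\<forall>x\<in>dom V. cinner (the (V x)) y = cinner x z" using z by auto
  have "(THE z. \<forall>x\<in>dom V. cinner (the (V x)) y = cinner x z) = z"
  proof (rule the_equality[of "\<lambda>z. \<forall>x\<in>dom V. cinner (the (V x)) y = cinner x z", OF adj])
    fix w assume "\<forall>x\<in>dom V. cinner (the (V x)) y = cinner x w"
    then show "w = z" using adj by (intro dense_cinner_eqI[OF dense_dom]) simp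
  qed
  then have "unbounded_adjoint V y = Some z"
    unfolding unbounded_adjoint_def using adj by auto
  then show ?thesis using sa by (simp add: self_adjoint_def)
qed

section \<open>Resolvents at the points \<i> and -\<i>, and the Cayley transform of
  \<open>V\<close>\<close>

lemma (in self_adjoint_operator) symmetric:
  assumes x: "V x = Some x'" and y: "V y = Some y'"
  shows "cinner x' y = cinner x y'"
proof -
  have adj: "unbounded_adjoint V y = Some y'" using sa y by (simp add: self_adjoint_def)
  then obtain z where z: "\<forall>x\<in>dom V. cinner (the (V x)) y = cinner x z"
    unfolding unbounded_adjoint_def by (auto split: if_splits)
  then have "V y = Some z" by (intro V_eq_SomeI) (metis domI option.sel)
  then show ?thesis using z x y by (metis domI option.inject option.sel)
qed

text \<open>Symmetry makes the inner product of \<open>x'\<close> and \<open>x\<close> real, so the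
  mixed term with the factor c is purely imaginary and drops out. In particular V + c is bounded
  below by 1.\<close>

lemma (in self_adjoint_operator) norm_resolvent:
  assumes x: "V x = Some x'" and c: "c = \<i> \<or> c = - \<i>"
  shows "(norm (x' + c *\<^sub>C x))\<^sup>2 = (norm x')\<^sup>2 + (norm x)\<^sup>2"
proof -
  have "cinner x' x = cnj (cinner x' x)"
    using symmetric[OF x x] cinner_commute[of x x'] by simp
  then have "Im (cinner x' x) = 0" by (simp add: complex_eq_iff)
  then have "Re (cinner x' (c *\<^sub>C x)) = 0" using c by (auto simp: cinner_scaleC_right)
  then show ?thesis using c by (auto simp: norm_add_square norm_scaleC)
qed

text \<open>The range of V + c is closed by the lower bound. A vector orthogonal to it is an
  eigenvector of \<open>V\<close> for the nonreal value c, or zero, and symmetry leaves only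
  zero.\<close>

lemma (in self_adjoint_operator) resolvent_exists:
  assumes c: "c = \<i> \<or> c = - \<i>"
  shows "\<exists>x x'. V x = Some x' \<and> x' + c *\<^sub>C x = y"
proof -
  define Ran where "Ran = {x' + c *\<^sub>C x |x x'. V x = Some x'}"
  have "closed Ran"
    unfolding closed_sequential_limits
  proof (intro allI impI, elim conjE)
    fix w l assume w: "\<forall>n. w n \<in> Ran" and lim: "w \<longlonglongrightarrow> l"
    then have "\<exists>x x'. V x = Some x' \<and> w n = x' + c *\<^sub>C x" for n unfolding Ran_def by blast
    then obtain x x' where V: "\<And>n. V (x n) = Some (x' n)" and eq: "\<And>n. w n = x' n + c *\<^sub>C x n"
      by metis
    have dist: "dist (x m) (x n) \<le> dist (w m) (w n)" for m n
    proof -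
      have Vd: "V (x m - x n) = Some (x' m - x' n)"
        using V_add[OF V V_scaleC[OF V, of "- 1"], of m n] by (simp add: scaleC_minus_one)
      have "(norm (x m - x n))\<^sup>2 \<le> (norm ((x' m - x' n) + c *\<^sub>C (x m - x n)))\<^sup>2"
        unfolding norm_resolvent[OF Vd c] by simp
      then have "norm (x m - x n) \<le> norm ((x' m - x' n) + c *\<^sub>C (x m - x n))"
        by (rule power2_le_imp_le) simp
      also have "(x' m - x' n) + c *\<^sub>C (x m - x n) = w m - w n" by (simp add: eq scaleC.diff_right)
      finally show ?thesis by (simp add: dist_norm)
    qed
    have "Cauchy x"
    proof (rule metric_CauchyI)
      fix e :: real assume "e > 0"
      then obtain N where "\<forall>m\<ge>N. \<forall>n\<ge>N. dist (w m) (w n) < e"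
        using metric_CauchyD[OF LIMSEQ_imp_Cauchy[OF lim]] by blast
      then show "\<exists>M. \<forall>m\<ge>M. \<forall>n\<ge>M. dist (x m) (x n) < e" using dist by (meson order.strict_trans1)
    qed
    then obtain p where p: "x \<longlonglongrightarrow> p" using Cauchy_convergent_iff convergent_def by blast
    have "x' = (\<lambda>n. w n - c *\<^sub>C x n)" using eq by (simp add: fun_eq_iff)
    then have x': "x' \<longlonglongrightarrow> l - c *\<^sub>C p"
      by (simp only:) (intro tendsto_diff lim scaleC.tendsto tendsto_const p)
    \<comment> \<open>Closedness of \<open>V\<close>: the symmetry relation against a fixed vector
      of the domain passes to the limit.\<close>
    have "V p = Some (l - c *\<^sub>C p)"
    proof (rule V_eq_SomeI)
      fix q q' assume q: "V q = Some q'"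
      have "(\<lambda>n. cinner q' (x n)) \<longlonglongrightarrow> cinner q' p" by (intro cinner.tendsto tendsto_const p)
      moreover have "(\<lambda>n. cinner q' (x n)) \<longlonglongrightarrow> cinner q (l - c *\<^sub>C p)"
        unfolding symmetric[OF q V] by (intro cinner.tendsto tendsto_const x')
      ultimately show "cinner q' p = cinner q (l - c *\<^sub>C p)" by (rule LIMSEQ_unique)
    qed
    then show "l \<in> Ran" unfolding Ran_def by force
  qed
  moreover have "0 \<in> Ran" unfolding Ran_def using V_0 by (force simp: scaleC.zero_right)
  moreover have "a + b \<in> Ran" if ab: "a \<in> Ran" "b \<in> Ran" for a b
  proof -
    obtain x x' z z' where "V x = Some x'" "a = x' + c *\<^sub>C x" "V z = Some z'" "b = z' + c *\<^sub>C z"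
      using ab unfolding Ran_def by blast
    then have "V (x + z) = Some (x' + z')" "a + b = (x' + z') + c *\<^sub>C (x + z)"
      using V_add by (auto simp: scaleC_add_right)
    then show ?thesis unfolding Ran_def by blast
  qed
  moreover have "k *\<^sub>C a \<in> Ran" if a: "a \<in> Ran" for k a
  proof -
    obtain x x' where "V x = Some x'" "a = x' + c *\<^sub>C x" using a unfolding Ran_def by blast
    then have "V (k *\<^sub>C x) = Some (k *\<^sub>C x')" "k *\<^sub>C a = k *\<^sub>C x' + c *\<^sub>C (k *\<^sub>C x)"
      using V_scaleC by (auto simp: scaleC_add_right scaleC_scaleC mult.commute)
    then show ?thesis unfolding Ran_def by blast
  qed
  ultimately obtain m where m: "m \<in> Ran" "\<And>a. a \<in> Ran \<Longrightarrow> cinner a (y - m) = 0"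
    by (rule orthogonal_decomposition[of Ran]) blast+
  define z where "z = y - m"
  have cc: "cnj c = - c" using c by auto
  have z: "V z = Some (c *\<^sub>C z)"
  proof (rule V_eq_SomeI)
    fix x x' assume x: "V x = Some x'"
    then have "cinner (x' + c *\<^sub>C x) z = 0" unfolding z_def by (intro m(2)) (auto simp: Ran_def)
    then show "cinner x' z = cinner x (c *\<^sub>C z)"
      by (simp add: cinner_add_left cinner_scaleC_left cinner_scaleC_right cc)
  qed
  have "cinner (c *\<^sub>C z) z = cinner z (c *\<^sub>C z)" by (rule symmetric[OF z z])
  then have "c * cinner z z = 0" by (simp add: cinner_scaleC_left cinner_scaleC_right cc)
  then have "z = 0" using c by auto
  then show ?thesis using m(1) unfolding Ran_def z_def by force
qed

text \<open>The inverse of V + c, with a plus sign, so that \<open>resolvent \<i>\<close> belongs to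
  the spectral parameter -\<i>.\<close>

definition (in self_adjoint_operator) resolvent :: "complex \<Rightarrow> 'a \<Rightarrow> 'a" where
  "resolvent c y = (SOME x. \<exists>x'. V x = Some x' \<and> x' + c *\<^sub>C x = y)"

lemma (in self_adjoint_operator) V_resolvent:
  assumes c: "c = \<i> \<or> c = - \<i>"
  shows "V (resolvent c y) = Some (y - c *\<^sub>C resolvent c y)"
proof -
  have "\<exists>x'. V (resolvent c y) = Some x' \<and> x' + c *\<^sub>C resolvent c y = y"
    unfolding resolvent_def using resolvent_exists[OF c, of y] by (rule someI_ex)
  then show ?thesis by (auto simp: eq_diff_eq)
qed

lemma (in self_adjoint_operator) resolvent_eqI:
  assumes c: "c = \<i> \<or> c = - \<i>" and x: "V x = Some x'" and y: "x' + c *\<^sub>C x = y"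
  shows "resolvent c y = x"
proof -
  let ?r = "resolvent c y"
  have "V (?r - x) = Some ((y - c *\<^sub>C ?r) - x')"
    using V_add[OF V_resolvent[OF c, of y] V_scaleC[OF x, of "- 1"]] by (simp add: scaleC_minus_one)
  from norm_resolvent[OF this c]
  have "(norm (?r - x))\<^sup>2 \<le> (norm ((y - c *\<^sub>C ?r) - x' + c *\<^sub>C (?r - x)))\<^sup>2" by simp
  also have "(y - c *\<^sub>C ?r) - x' + c *\<^sub>C (?r - x) = 0" using y by (simp add: scaleC.diff_right algebra_simps)
  finally show ?thesis by simp
qed

lemma (in self_adjoint_operator) resolvent_bounded_ops:
  assumes c: "c = \<i> \<or> c = - \<i>"
  shows "resolvent c \<in> bounded_ops"
proof (rule bounded_opsI[where K = 1])
  show "resolvent c (x + y) = resolvent c x + resolvent c y" for x y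
    by (rule resolvent_eqI[OF c V_add[OF V_resolvent[OF c] V_resolvent[OF c]]])
      (simp add: scaleC_add_right)
  show "resolvent c (k *\<^sub>C x) = k *\<^sub>C resolvent c x" for k x
    by (rule resolvent_eqI[OF c V_scaleC[OF V_resolvent[OF c]]])
      (simp add: scaleC_scaleC scaleC.diff_right mult.commute)
  show "norm (resolvent c x) \<le> 1 * norm x" for x
  proof -
    have "(norm (resolvent c x))\<^sup>2 \<le> (norm x)\<^sup>2"
      using norm_resolvent[OF V_resolvent[OF c, of x] c] by simp
    then have "norm (resolvent c x) \<le> norm x" by (rule power2_le_imp_le) simp
    then show ?thesis by simp
  qed
qed

text \<open>The map U = 1 - 2 \<i> (V + \<i>)^(-1) sends V x + \<i> x to V x - \<i> x, and
  \<open>U'\<close> sends it back. Writing arbitrary vectors in these two forms reduces the inverse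
  and adjoint laws to computations with \<open>symmetric\<close>.\<close>

lemma (in self_adjoint_operator) cayley_pair_resolvent:
  "cayley_pair (\<lambda>y. y - (2 * \<i>) *\<^sub>C resolvent \<i> y) (\<lambda>y. y + (2 * \<i>) *\<^sub>C resolvent (- \<i>) y)"
  (is "cayley_pair ?U ?U'")
proof
  have U: "?U (x' + \<i> *\<^sub>C x) = x' - \<i> *\<^sub>C x" and U': "?U' (x' - \<i> *\<^sub>C x) = x' + \<i> *\<^sub>C x"
    if x: "V x = Some x'" for x x'
  proof -
    have "resolvent \<i> (x' + \<i> *\<^sub>C x) = x" by (rule resolvent_eqI[OF _ x]) auto
    moreover have "resolvent (- \<i>) (x' - \<i> *\<^sub>C x) = x"
      by (rule resolvent_eqI[OF _ x]) (auto simp: scaleC.minus_left)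
    moreover have "(2 * \<i>) *\<^sub>C x = \<i> *\<^sub>C x + \<i> *\<^sub>C x"
      unfolding scaleC_add_left[symmetric] by simp
    ultimately show "?U (x' + \<i> *\<^sub>C x) = x' - \<i> *\<^sub>C x" "?U' (x' - \<i> *\<^sub>C x) = x' + \<i> *\<^sub>C x"
      by simp_all
  qed
  have plus: "\<exists>x x'. V x = Some x' \<and> y = x' + \<i> *\<^sub>C x" for y
    using resolvent_exists[of \<i> y] by blast
  have minus: "\<exists>x x'. V x = Some x' \<and> y = x' - \<i> *\<^sub>C x" for y
    using resolvent_exists[of "- \<i>" y] by (auto simp: scaleC.minus_left)
  show "?U \<in> bounded_ops"
    using bounded_ops_plus[OF id_bounded_ops bounded_ops_scale[OF resolvent_bounded_ops, of \<i> "- (2 * \<i>)"]]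
    by (simp add: scaleC.minus_left)
  show "?U' \<in> bounded_ops"
    using bounded_ops_plus[OF id_bounded_ops bounded_ops_scale[OF resolvent_bounded_ops, of "- \<i>" "2 * \<i>"]]
    by simp
  fix a b
  obtain x x' where x: "V x = Some x'" "a = x' + \<i> *\<^sub>C x" using plus by blast
  obtain y y' where y: "V y = Some y'" "b = y' - \<i> *\<^sub>C y" using minus by blast
  obtain z z' where z: "V z = Some z'" "a = z' - \<i> *\<^sub>C z" using minus by blast
  show "?U (?U' a) = a" unfolding z(2) U'[OF z(1)] U[OF z(1)] ..
  show "?U' (?U a) = a" unfolding x(2) U[OF x(1)] U'[OF x(1)] ..
  show "cinner (?U a) b = cinner a (?U' b)"
    unfolding x(2) y(2) U[OF x(1)] U'[OF y(1)] using symmetric[OF x(1) y(1)]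
    by (simp add: cinner_add_left cinner_add_right cinner.diff_left cinner.diff_right
        cinner_scaleC_left cinner_scaleC_right algebra_simps)
next
  have "dom V \<subseteq> range (\<lambda>y. y - ?U y)"
  proof
    fix x assume "x \<in> dom V"
    then obtain x' where x: "V x = Some x'" by blast
    \<comment> \<open>Since y - U y is 2 \<i> times the resolvent of y, the vector x is hit by y =
      (V + \<i>)(x / (2 \<i>)).\<close>
    let ?k = "1 / (2 * \<i>)"
    have "V (?k *\<^sub>C x) = Some (?k *\<^sub>C x')" by (rule V_scaleC[OF x])
    then have "resolvent \<i> (?k *\<^sub>C x' + \<i> *\<^sub>C (?k *\<^sub>C x)) = ?k *\<^sub>C x"
      by (intro resolvent_eqI) auto
    then have "x = (\<lambda>y. y - ?U y) (?k *\<^sub>C x' + \<i> *\<^sub>C (?k *\<^sub>C x))"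
      by (simp add: scaleC_scaleC)
    then show "x \<in> range (\<lambda>y. y - ?U y)" by (rule range_eqI)
  qed
  then show "closure (range (\<lambda>y. y - ?U y)) = UNIV"
    using closure_mono dense_dom by blast
qed

theorem (in self_adjoint_operator) spectral_theorem: "\<exists>E. is_spectral_measure V E"
proof -
  define R where "R = resolvent \<i>"
  interpret cayley_pair "\<lambda>y. y - (2 * \<i>) *\<^sub>C resolvent \<i> y" "\<lambda>y. y + (2 * \<i>) *\<^sub>C resolvent (- \<i>) y"
    by (rule cayley_pair_resolvent)
  define r where "r l = 1 / (complex_of_real l + \<i>)" for l
  obtain S where R: "calc r R S"
  proof -
    let ?U = "\<lambda>y. y - (2 * \<i>) *\<^sub>C resolvent \<i> y" and ?U' = "\<lambda>y. y + (2 * \<i>) *\<^sub>C resolvent (- \<i>) y"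
    have "monomial_triple ?U ?U' cayley ?U ?U'"
      unfolding monomial_triple_def by (rule exI[of _ 1], rule exI[of _ 0]) simp
    then have "calc cayley ?U ?U'" by (rule calc.base)
    \<comment> \<open>The constants solve \<open>cayley l = 1 - 2 * \<i> * r l\<close> for
      \<open>r\<close>.\<close>
    from calc.add[OF calc.scale[OF calc.base[OF base_one], of "- \<i> / 2"] calc.scale[OF this, of "\<i> / 2"]]
    obtain S where S: "calc (\<lambda>l. (- \<i> / 2) * 1 + (\<i> / 2) * cayley l)
        (\<lambda>x. (- \<i> / 2) *\<^sub>C id x + (\<i> / 2) *\<^sub>C ?U x) S" by blast
    have "(\<lambda>l. (- \<i> / 2) * 1 + (\<i> / 2) * cayley l) = r"
    proof
      fix l
      have "cayley l = (complex_of_real l + \<i> - 2 * \<i>) / (complex_of_real l + \<i>)" by (simp add: cayley_def)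
      also have "\<dots> = 1 - 2 * \<i> * r l" by (simp only: diff_divide_distrib r_def) simp
      finally have "cayley l = 1 - 2 * \<i> * r l" .
      then show "(- \<i> / 2) * 1 + (\<i> / 2) * cayley l = r l" by (simp only:) (simp add: algebra_simps)
    qed
    moreover have "(\<lambda>x. (- \<i> / 2) *\<^sub>C id x + (\<i> / 2) *\<^sub>C ?U x) = R"
    proof
      fix x
      show "(- \<i> / 2) *\<^sub>C id x + (\<i> / 2) *\<^sub>C ?U x = R x"
        by (simp add: R_def scaleC.diff_right scaleC_scaleC scaleC.minus_left)
    qed
    ultimately show ?thesis using S that by simp
  qed
  have V_R: "V (R y) = Some (y - \<i> *\<^sub>C R y)" for y
    unfolding R_def by (rule V_resolvent) simp
  have r2: "(cmod (r l))\<^sup>2 = 1 / (1 + l\<^sup>2)" for l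
  proof -
    have "(cmod (complex_of_real l + \<i>))\<^sup>2 = 1 + l\<^sup>2" by (simp add: cmod_power2)
    then show ?thesis unfolding r_def norm_divide power_divide by simp
  qed
  have pos: "0 < 1 + l\<^sup>2" for l :: real by (metis add_pos_nonneg zero_le_power2 zero_less_one)
  have \<nu>_R: "\<nu> (R y) = density (\<nu> y) (\<lambda>l. 1 / (1 + l\<^sup>2))" for y
    using \<nu>_calc[OF R, of y] by (simp only: r2)
  have meas: "(\<lambda>l. 1 / (1 + l\<^sup>2)) \<in> borel_measurable (\<nu> y)" "(\<lambda>l. l\<^sup>2) \<in> borel_measurable (\<nu> y)"
    "(\<lambda>l. complex_of_real l) \<in> borel_measurable (\<nu> y)" for y
    by (rule measurable_\<mu>, measurable)+
  \<comment> \<open>The density 1 / (1 + l^2) compensates the growth of l^2. As the range of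
    \<open>R\<close> contains \<open>dom V\<close>, this gives one inclusion between the
    domains.\<close>
  have square_integrable: "integrable (\<nu> (R y)) (\<lambda>l. l\<^sup>2)" for y
  proof -
    have "integrable (\<nu> y) (\<lambda>l. (1 / (1 + l\<^sup>2)) *\<^sub>R l\<^sup>2)"
    proof (rule integrable_bounded[where K = 1])
      show "norm ((1 / (1 + l\<^sup>2)) *\<^sub>R l\<^sup>2) \<le> 1" for l :: real using pos[of l] by simp
    qed measurable
    then show ?thesis unfolding \<nu>_R using pos
      by (subst integrable_density[OF meas(2,1)]) (auto intro: less_imp_le)
  qed
  have form: "cinner (R y) (y - \<i> *\<^sub>C R y) = (LINT l|\<nu> (R y). complex_of_real l)" for y
  proof -
    \<comment> \<open>This writes the transported integrand through \<open>cnj (r l)\<close> and |r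
      l|^2, whose operators are \<open>S\<close> and \<open>S \<circ> R\<close>; moving
      \<open>S\<close> across the inner product produces the vector y - \<i> R y, which is V (R
      y).\<close>
    have pt: "(1 / (1 + l\<^sup>2)) *\<^sub>R complex_of_real l = cnj (r l) - \<i> * (cnj (r l) * r l)" for l
    proof -
      define w where "w = complex_of_real (1 / (1 + l\<^sup>2))"
      have rr: "cnj (r l) * r l = w"
        by (simp only: w_def r2[symmetric] complex_norm_square mult.commute)
      have "cnj (r l) = (complex_of_real l + \<i>) * (cnj (r l) * r l)" by (simp add: r_def)
      then have r: "cnj (r l) = (complex_of_real l + \<i>) * w" by (simp only: rr)
      have "cnj (r l) - \<i> * (cnj (r l) * r l) = w * complex_of_real l"
        unfolding rr unfolding r by (simp add: algebra_simps)
      then show ?thesis by (simp only: scaleR_conv_of_real w_def)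
    qed
    have int1: "integrable (\<nu> y) (\<lambda>l. cnj (r l))" and int2: "integrable (\<nu> y) (\<lambda>l. cnj (r l) * r l)"
      using calc_integrable[OF calc_cnj[OF R]] calc_integrable[OF calc_mult[OF R calc_cnj[OF R]]] by auto
    have "(LINT l|\<nu> (R y). complex_of_real l) = (LINT l|\<nu> y. (1 / (1 + l\<^sup>2)) *\<^sub>R complex_of_real l)"
      unfolding \<nu>_R using pos by (intro integral_density[OF meas(3,1)]) (auto intro: less_imp_le)
    also have "\<dots> = (LINT l|\<nu> y. cnj (r l)) - \<i> * (LINT l|\<nu> y. cnj (r l) * r l)"
      unfolding pt using int1 int2 by simp
    also have "\<dots> = cinner y (S y) - \<i> * cinner y ((S \<circ> R) y)"
      unfolding calc_form[OF calc_cnj[OF R]] calc_form[OF calc_mult[OF R calc_cnj[OF R]]] ..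
    also have "\<dots> = cinner (R y) (y - \<i> *\<^sub>C R y)"
      by (simp add: calc_adjoint[OF R] cinner.diff_right cinner_scaleC_right)
    finally show ?thesis ..
  qed
  \<comment> \<open>The opposite inclusion needs a preimage of \<open>x\<close> under
    \<open>R\<close>, formally the multiplier l + \<i> applied to \<open>x\<close>. Cutting off to
    \<open>B n\<close> gives bounded multipliers \<open>g n\<close> with r g n = indicator of
    \<open>B n\<close>; their values at \<open>x\<close> converge and \<open>R\<close> is
    continuous.\<close>
  have in_range: "\<exists>y. x = R y" if int: "integrable (\<nu> x) (\<lambda>l. l\<^sup>2)" for x
  proof -
    define B where "B n = {- real n..real n}" for n
    have B: "B n \<in> sets borel" for n by (simp add: B_def)
    define g where "g n l = (complex_of_real l + \<i>) * indicator (B n) l" for n l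
    have g_le: "cmod (g n l) \<le> sqrt (1 + l\<^sup>2)" for n l
      by (auto simp: g_def norm_mult indicator_def cmod_def add.commute)
    have "\<exists>G Q. calc (g n) G Q" for n
    proof (rule calc_exists)
      show "g n \<in> borel_measurable borel" unfolding g_def using B by measurable
      show "cmod (g n l) \<le> real n + 1" for l
        using norm_triangle_ineq[of "complex_of_real l" \<i>]
        by (auto simp: g_def indicator_def B_def)
    qed
    then obtain G Q where G: "\<And>n. calc (g n) (G n) (Q n)" by metis
    have ev: "\<forall>\<^sub>F n in sequentially. l \<in> B n" for l
    proof -
      obtain N where "\<bar>l\<bar> \<le> real N" using real_arch_simple by blast
      then have "l \<in> B n" if "n \<ge> N" for n using that by (auto simp: B_def)
      then show ?thesis unfolding eventually_sequentially by blast
    qed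
    have g_lim: "(\<lambda>n. g n l) \<longlonglongrightarrow> complex_of_real l + \<i>" for l
      by (rule tendsto_eventually, rule eventually_mono[OF ev[of l]]) (simp add: g_def)
    have "integrable (\<nu> x) (\<lambda>l. (sqrt (1 + l\<^sup>2))\<^sup>2)"
      using Bochner_Integration.integrable_add[OF finite_measure.integrable_const[OF finite_\<mu>, of x 1] int] pos
      by (simp add: less_imp_le)
    \<comment> \<open>The cutoffs have no common bound. Here the assumed integrability of l^2 at
      this vector enters, with majorant sqrt(1 + l^2).\<close>
    then have "convergent (\<lambda>n. G n x)" by (rule calc_convergent[OF G g_le _ g_lim])
    then obtain y where y: "(\<lambda>n. G n x) \<longlonglongrightarrow> y" by (auto simp: convergent_def)
    have RG: "R (G n x) = spectral (B n) x" for n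
    proof -
      have "(\<lambda>l. r l * g n l) = indicator (B n)" by (auto simp: r_def g_def)
      then have "calc (indicator (B n)) (R \<circ> G n) (Q n \<circ> S)" 
        using calc_mult[OF G[of n] R] by (simp only:)
      then have "R \<circ> G n = spectral (B n)" by (rule calc_unique[OF _ calc_spectral[OF B]])
      then show ?thesis by (simp add: fun_eq_iff)
    qed
    obtain T S' where T: "calc (\<lambda>_. 1) T S'" "\<And>x. (\<lambda>n. spectral (B n) x) \<longlonglongrightarrow> T x"
    proof (rule calc_limE[OF calc_spectral[OF B], where K = 1 and f = "\<lambda>_. 1"])
      show "cmod (indicator (B n) l) \<le> 1" for n l by (simp add: indicator_def)
      show "(\<lambda>n. indicator (B n) l) \<longlonglongrightarrow> (1::complex)" for l
        by (rule tendsto_eventually, rule eventually_mono[OF ev[of l]]) simp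
    qed blast
    have "T = id" by (rule calc_unique[OF T(1) calc.base[OF base_one]])
    then have "(\<lambda>n. R (G n x)) \<longlonglongrightarrow> x" using T(2)[of x] by (simp add: RG)
    moreover have "(\<lambda>n. R (G n x)) \<longlonglongrightarrow> R y"
      by (rule bounded_linear.tendsto[OF bounded_ops_bounded_linear[OF calc_bounded_ops(1)[OF R]] y])
    ultimately have "x = R y" by (rule LIMSEQ_unique)
    then show ?thesis by blast
  qed
  have R_V: "x = R (x' + \<i> *\<^sub>C x)" if "V x = Some x'" for x x'
    unfolding R_def by (rule resolvent_eqI[symmetric, OF _ that]) auto
  have "is_spectral_integral spectral complex_of_real V"
    unfolding is_spectral_integral_def scalar_measure_spectral
  proof (intro conjI ballI)
    show "linear_operator V" using sa by (simp add: self_adjoint_def)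
    show "dom V = {x. integrable (\<nu> x) (\<lambda>l. (cmod (complex_of_real l))\<^sup>2)}"
    proof (intro set_eqI iffI)
      fix x assume "x \<in> dom V"
      then obtain x' where "V x = Some x'" by blast
      then have "x = R (x' + \<i> *\<^sub>C x)" by (rule R_V)
      then show "x \<in> {x. integrable (\<nu> x) (\<lambda>l. (cmod (complex_of_real l))\<^sup>2)}"
        using square_integrable[of "x' + \<i> *\<^sub>C x"] by simp
    next
      fix x assume "x \<in> {x. integrable (\<nu> x) (\<lambda>l. (cmod (complex_of_real l))\<^sup>2)}"
      then obtain y where "x = R y" using in_range[of x] by auto
      then show "x \<in> dom V" using V_R[of y] by blast
    qed
    fix x assume "x \<in> dom V"
    then obtain x' where x': "V x = Some x'" by blast
    have "R (x' + \<i> *\<^sub>C x) = x" using R_V[OF x'] by simp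
    then show "cinner x (the (V x)) = (LINT l|\<nu> x. complex_of_real l)"
      using form[of "x' + \<i> *\<^sub>C x"] x' by simp
  qed
  moreover have "projection_valued_measure spectral"
    using projection_measure_spectral by (simp add: projection_measure_def)
  ultimately show ?thesis unfolding is_spectral_measure_def by blast
qed

theorem proposition5p2:
  fixes V :: "'a::complex_hilbert_space \<rightharpoonup> 'a"
    and U :: "real \<Rightarrow> 'a \<Rightarrow> 'a"
  assumes "self_adjoint V"
    and "\<And>t. U t = exp_itV V t"
  shows "von_neumann_generated (spectral_projections V) = commutant (commutant (range U))"
proof -
  interpret self_adjoint_operator V by unfold_locales (rule assms(1))
  \<comment> \<open>Existence guarantees that the choice inside \<open>spectral_measure\<close>
    really is a spectral measure.\<close>
  have "is_spectral_measure V (spectral_measure V)"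
    unfolding spectral_measure_def using spectral_theorem by (rule someI_ex)
  then show ?thesis using assms(2) by (rule exp_itV_double_commutant)
qed

end
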